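(* Let $m,n\geq 1$, $\nu\geq 0$ and $0\leq s\leq n$ be integers, let $k_1=\cdots=k_s=\nu+1$ and $k_{s+1}=\cdots=k_n=\nu$, and let $\Sigma=\Sigma^{k_1,\ldots,k_n;\mathbf{1}}_{m,n}$ be the associated symmetric multiple chessboard complex. If $m\geq n(\nu+1)+s-1$, then $\Sigma$ is $\mu$-connected, where $\mu=k_1+\cdots+k_n-2=\nu n+s-2$.
   Context: Consider the chessboard $[m]\times[n]$ with $m$ columns and $n$ rows; its squares are the vertices. For nonnegative integers $a_1,\dots,a_n$, the multiple chessboard complex $\Delta^{a_1,\ldots,a_n;\mathbf{1}}_{m,n}$ is the simplicial complex of all rook placements $A\subseteq[m]\times[n]$ with at most one rook in each column and at most $a_i$ rooks in the $i$-th row. The symmetric multiple chessboard complex is $\Sigma^{k_1,\ldots,k_n;\mathbf{1}}_{m,n}=\bigcup_{\pi\in S_n}\Delta^{k_{\pi(1)},\ldots,k_{\pi(n)};\mathbf{1}}_{m,n}$. A space is $\mu$-connected if it is nonempty and its homotopy groups $\pi_i$ vanish for $0\leq i\leq\mu$.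
   Formalization: For μ = −2 (that is, ν = 0 and s = 0), where Σ has only the empty face and its realization is empty, μ-connected is taken to impose no condition; nonemptiness is required only for μ ≥ −1. *)

theory Defs
  imports "HOL-Analysis.Analysis"
begin

section \<open>Chessboard complexes\<close>

text \<open>A square is a pair (column, row). An abstract simplicial complex is given by its set of
  faces, the empty face included.\<close>

definition chessboard :: "nat \<Rightarrow> nat \<Rightarrow> (nat \<times> nat) set" where
  "chessboard m n = {1..m} \<times> {1..n}"

definition multiple_chessboard_complex ::
    "nat \<Rightarrow> nat \<Rightarrow> (nat \<Rightarrow> nat) \<Rightarrow> (nat \<times> nat) set set" where
  "multiple_chessboard_complex m n a =
     {A. A \<subseteq> chessboard m n \<and>
         (\<forall>c\<in>{1..m}. card {p\<in>A. fst p = c} \<le> 1) \<and>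
         (\<forall>r\<in>{1..n}. card {p\<in>A. snd p = r} \<le> a r)}"

definition symmetric_multiple_chessboard_complex ::
    "nat \<Rightarrow> nat \<Rightarrow> (nat \<Rightarrow> nat) \<Rightarrow> (nat \<times> nat) set set" where
  "symmetric_multiple_chessboard_complex m n k =
     (\<Union>\<pi>\<in>{\<pi>. \<pi> permutes {1..n}}. multiple_chessboard_complex m n (\<lambda>r. k (\<pi> r)))"


section \<open>Geometric realization\<close>

text \<open>Points are given by barycentric coordinates. The subspace topology used here is the usual
  (coherent) topology of the realization when the complex is finite; chessboard complexes are.\<close>

definition geometric_realization :: "'v set set \<Rightarrow> ('v \<Rightarrow> real) topology" where
  "geometric_realization K =
     subtopology (powertop_real UNIV)
       {x. (\<forall>v. 0 \<le> x v) \<and> {v. x v \<noteq> 0} \<in> K \<and> (\<Sum>v | x v \<noteq> 0. x v) = 1}"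


section \<open>Homotopy groups and connectedness\<close>

text \<open>The cube of dimension 0 is a single point with empty boundary.\<close>

definition unit_cube :: "nat \<Rightarrow> (nat \<Rightarrow> real) topology" where
  "unit_cube i = product_topology (\<lambda>_. top_of_set {0..1}) {..<i}"

definition cube_boundary :: "nat \<Rightarrow> (nat \<Rightarrow> real) set" where
  "cube_boundary i = {t \<in> topspace (unit_cube i). \<exists>j<i. t j = 0 \<or> t j = 1}"

definition based_cube_maps :: "nat \<Rightarrow> 'a topology \<Rightarrow> 'a \<Rightarrow> ((nat \<Rightarrow> real) \<Rightarrow> 'a) set" where
  "based_cube_maps i X x0 =
     {f. continuous_map (unit_cube i) X f \<and> (\<forall>t\<in>cube_boundary i. f t = x0)}"

definition based_homotopy_rel ::
    "nat \<Rightarrow> 'a topology \<Rightarrow> 'a \<Rightarrow> (((nat \<Rightarrow> real) \<Rightarrow> 'a) \<times> ((nat \<Rightarrow> real) \<Rightarrow> 'a)) set" where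
  "based_homotopy_rel i X x0 =
     {(f, g). homotopic_with (\<lambda>h. \<forall>t\<in>cube_boundary i. h t = x0) (unit_cube i) X f g}"

text \<open>The underlying set of the i-th homotopy group of X at x0; for i = 0 it is the set of path
  components of X. The group operation is not needed to say that the group is trivial.\<close>

definition homotopy_group ::
    "nat \<Rightarrow> 'a topology \<Rightarrow> 'a \<Rightarrow> ((nat \<Rightarrow> real) \<Rightarrow> 'a) set set" where
  "homotopy_group i X x0 = based_cube_maps i X x0 // based_homotopy_rel i X x0"

lemma equiv_based_homotopy_rel: "equiv (based_cube_maps i X x0) (based_homotopy_rel i X x0)"
proof (rule equivI)
  show "based_homotopy_rel i X x0 \<subseteq> based_cube_maps i X x0 \<times> based_cube_maps i X x0"
    unfolding based_homotopy_rel_def based_cube_maps_def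
    by (auto dest: homotopic_with_imp_continuous_maps homotopic_with_imp_property)
  show "refl_on (based_cube_maps i X x0) (based_homotopy_rel i X x0)"
    by (auto simp: refl_on_def based_homotopy_rel_def based_cube_maps_def)
  show "sym (based_homotopy_rel i X x0)"
    unfolding sym_def based_homotopy_rel_def
    by (blast intro: homotopic_with_symD)
  show "trans (based_homotopy_rel i X x0)"
    unfolding trans_def based_homotopy_rel_def
    by (blast intro: homotopic_with_trans)
qed

text \<open>The standard convention for small indices: (-1)-connected means nonempty, and every space is
  \<mu>-connected for \<mu> at most -2. For \<mu> at least 0, vanishing is required at all base points.\<close>

definition mu_connected :: "int \<Rightarrow> 'a topology \<Rightarrow> bool" where
  "mu_connected \<mu> X \<longleftrightarrow>
     (\<mu> \<ge> -1 \<longrightarrow> topspace X \<noteq> {}) \<and>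
     (\<forall>i. int i \<le> \<mu> \<longrightarrow> (\<forall>x0\<in>topspace X. is_singleton (homotopy_group i X x0)))"

end

theory Submission
  imports Defs
begin

text \<open>Call a space fillable in dimension p if every map from the boundary of a p-cube extends over
  the cube. Gluing principle: for a vertex v of a complex K, the realization of K is covered by the
  open sets where the barycentric coordinate of v is less than 1 (which deforms to the deletion of v)
  and where it is positive (which contracts to v), with intersection equivalent to the link of v.
  Hence K is fillable below dimension D if its deletion is, and if its link is fillable below D - 1.

  The complex is generalized to boards V with row capacities a r, where at most s rows may exceed
  their capacity, by one rook each. Fix a row r0 and a square (c, r0). Delete the other squares of
  column c, then the other squares of row r0, until (c, r0) is a cone point (or row r0 is empty);
  the links met on the way are boards of the same kind with one rook fewer. The bound on the row
  sizes survives because each rook placed costs a row at most one square, and the square lost by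
  deleting column c is recovered when row r0 is exhausted and drops out.\<close>

section \<open>Filling cubes\<close>

text \<open>Homotopy groups enter only at the very end. Extending maps from cube boundaries needs no
  base points and treats nonemptiness, path connectedness and the higher groups alike, so that a
  single gluing statement does the work of van Kampen, Mayer-Vietoris and Hurewicz. The obstacle on
  the combinatorial side is that the link of a square in a symmetric complex is no longer symmetric.
  A budget of \<open>s\<close> excess rooks, in place of the union over permutations, gives a class
  closed under links: a rook in a row of positive capacity lowers that capacity, while a rook in a
  row of capacity 0 spends one unit of the budget and closes the row. Either way the sum of the
  capacities plus \<open>s\<close>, which is the bound \<open>D\<close>, drops by exactly one.
  Deletions are the dangerous moves, since they shorten rows while \<open>D\<close> stays. They are
  therefore confined to one column, at the price of one square per row, and then to one row whose
  own length no longer matters. The boards before and after the column is cleared satisfy different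
  bounds, hence the two invariants \<open>rich\<close> and \<open>rich_but_one\<close> in one joint
  induction.\<close>

text \<open>Cubes are boxes in the space of all sequences that are degenerate in all but finitely many
  directions, so that faces and subdivisions of a cube are again cubes, without reparametrization.\<close>

definition cell :: "(nat \<Rightarrow> real) \<Rightarrow> (nat \<Rightarrow> real) \<Rightarrow> (nat \<Rightarrow> real) set" where
  "cell lo hi = {t. \<forall>i. lo i \<le> t i \<and> t i \<le> hi i}"

definition dirs :: "(nat \<Rightarrow> real) \<Rightarrow> (nat \<Rightarrow> real) \<Rightarrow> nat set" where
  "dirs lo hi = {i. lo i < hi i}"

definition bdry :: "(nat \<Rightarrow> real) \<Rightarrow> (nat \<Rightarrow> real) \<Rightarrow> (nat \<Rightarrow> real) set" where
  "bdry lo hi = {t \<in> cell lo hi. \<exists>i\<in>dirs lo hi. t i = lo i \<or> t i = hi i}"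

definition is_cell :: "nat \<Rightarrow> (nat \<Rightarrow> real) \<Rightarrow> (nat \<Rightarrow> real) \<Rightarrow> bool" where
  "is_cell p lo hi \<longleftrightarrow> (\<forall>i. lo i \<le> hi i) \<and> finite (dirs lo hi) \<and> card (dirs lo hi) = p"

text \<open>In dimension 0 the boundary is empty, so \<open>fillable 0 S\<close> says that
  \<open>S\<close> is nonempty. \<open>fillable (Suc i) S\<close> is what makes the i-th homotopy
  group trivial at every base point.\<close>

definition fillable :: "nat \<Rightarrow> 'a::topological_space set \<Rightarrow> bool" where
  "fillable p S \<longleftrightarrow>
     (\<forall>lo hi f. is_cell p lo hi \<and> continuous_on (bdry lo hi) f \<and> f ` bdry lo hi \<subseteq> S \<longrightarrow>
        (\<exists>F. continuous_on (cell lo hi) F \<and> F ` cell lo hi \<subseteq> S \<and> (\<forall>t\<in>bdry lo hi. F t = f t)))"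

lemma continuous_on_coord: "continuous_on S (\<lambda>t. t i :: 'b::topological_space)"
  by (rule continuous_on_subset[OF continuous_on_product_coordinates]) auto

lemma continuous_on_coord_comp:
  fixes f :: "'c::topological_space \<Rightarrow> 'a \<Rightarrow> 'b::topological_space"
  shows "continuous_on S f \<Longrightarrow> continuous_on S (\<lambda>t. f t i)"
  by (rule continuous_on_product_then_coordinatewise)

lemma compact_cell: "compact (cell lo hi)"
proof -
  have "cell lo hi = (\<Pi>\<^sub>E i\<in>UNIV. {lo i..hi i})"
    by (auto simp: cell_def PiE_def Pi_def)
  moreover have "compactin (product_topology (\<lambda>i. euclidean) UNIV) (\<Pi>\<^sub>E i\<in>UNIV. {lo i..hi i})"
    by (subst compactin_PiE) auto
  ultimately show ?thesis
    by (simp add: euclidean_product_topology)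
qed

lemma closed_cell: "closed (cell lo hi)"
proof -
  have "cell lo hi = (\<Inter>i. {t. lo i \<le> t i} \<inter> {t. t i \<le> hi i})"
    by (auto simp: cell_def)
  moreover have "closed ({t::nat\<Rightarrow>real. lo i \<le> t i} \<inter> {t. t i \<le> hi i})" for i
    by (intro closed_Int closed_Collect_le continuous_on_const continuous_on_coord)
  ultimately show ?thesis by auto
qed

lemma closed_bdry:
  assumes "finite (dirs lo hi)" shows "closed (bdry lo hi)"
proof -
  have "bdry lo hi = (\<Union>i\<in>dirs lo hi. cell lo hi \<inter> ({t. t i = lo i} \<union> {t. t i = hi i}))"
    by (auto simp: bdry_def)
  moreover have "closed \<dots>"
    by (intro closed_UN assms ballI closed_Int closed_Un closed_cell closed_Collect_eq
        continuous_on_const continuous_on_coord)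
  ultimately show ?thesis by (simp only:)
qed

lemma bdry_subset_cell: "bdry lo hi \<subseteq> cell lo hi"
  by (auto simp: bdry_def)

text \<open>Every box, even one of dimension 0, has a point off its boundary. This excludes that a
  box covered by two sets meets both of them in boundary points only.\<close>

lemma midpoint_in_cell:
  assumes "\<forall>i. lo i \<le> hi i"
  shows "(\<lambda>i. (lo i + hi i) / 2) \<in> cell lo hi - bdry lo hi"
  using assms by (auto simp: cell_def bdry_def dirs_def field_simps)

text \<open>A pair \<open>(i, x)\<close> stands for the hyperplane where coordinate i equals x. A
  box that is degenerate in direction i may lie inside such a hyperplane.\<close>

definition atomic :: "(nat \<times> real) set \<Rightarrow> (nat \<Rightarrow> real) \<Rightarrow> (nat \<Rightarrow> real) \<Rightarrow> bool" where
  "atomic Cu lo hi \<longleftrightarrow> (\<forall>(i, x)\<in>Cu. \<not> (lo i < x \<and> x < hi i))"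

text \<open>A union of closed blocks cut out by Cu is adapted to Cu: a box that Cu does not subdivide lies
  inside it or meets it in boundary points only.\<close>

definition adapted :: "(nat \<times> real) set \<Rightarrow> (nat \<Rightarrow> real) set \<Rightarrow> bool" where
  "adapted Cu P \<longleftrightarrow>
     (\<forall>lo hi. atomic Cu lo hi \<longrightarrow> cell lo hi \<subseteq> P \<or> cell lo hi \<inter> P \<subseteq> bdry lo hi)"

text \<open>If only one of \<open>P\<close> and \<open>Q\<close> contains the box, the other meets
  it in boundary points, where the condition already holds for \<open>f\<close>; filling inside the
  one target set is then enough. Only a box lying in both needs a filling inside
  \<open>A \<inter> B\<close>.\<close>

lemma fill_atomic:
  assumes at: "atomic Cu lo hi" and P: "adapted Cu P" and Q: "adapted Cu Q"
    and cov: "cell lo hi \<subseteq> P \<union> Q" and c: "is_cell p lo hi"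
    and f: "continuous_on (bdry lo hi) f" "f ` (bdry lo hi \<inter> P) \<subseteq> A" "f ` (bdry lo hi \<inter> Q) \<subseteq> B"
    and fA: "fillable p A" and fB: "fillable p B"
    and fAB: "cell lo hi \<subseteq> P \<inter> Q \<Longrightarrow> fillable p (A \<inter> B)"
  shows "\<exists>F. continuous_on (cell lo hi) F \<and> F ` (cell lo hi \<inter> P) \<subseteq> A \<and> F ` (cell lo hi \<inter> Q) \<subseteq> B \<and>
           (\<forall>t\<in>bdry lo hi. F t = f t)"
proof -
  have m: "(\<lambda>i. (lo i + hi i) / 2) \<in> cell lo hi - bdry lo hi"
    using c midpoint_in_cell by (auto simp: is_cell_def)
  have Pd: "cell lo hi \<subseteq> P \<or> cell lo hi \<inter> P \<subseteq> bdry lo hi"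
    using P at by (auto simp: adapted_def)
  have Qd: "cell lo hi \<subseteq> Q \<or> cell lo hi \<inter> Q \<subseteq> bdry lo hi"
    using Q at by (auto simp: adapted_def)
  have bs: "t \<in> cell lo hi" if "t \<in> bdry lo hi" for t
    using that bdry_subset_cell by blast
  have fill: "\<exists>F. continuous_on (cell lo hi) F \<and> F ` cell lo hi \<subseteq> S \<and> (\<forall>t\<in>bdry lo hi. F t = f t)"
    if "fillable p S" "f ` bdry lo hi \<subseteq> S" for S
    using that c f(1) unfolding fillable_def by blast
  consider (PQ) "cell lo hi \<subseteq> P" "cell lo hi \<subseteq> Q"
    | (P) "cell lo hi \<subseteq> P" "cell lo hi \<inter> Q \<subseteq> bdry lo hi"
    | (Q) "cell lo hi \<subseteq> Q" "cell lo hi \<inter> P \<subseteq> bdry lo hi"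
    using Pd Qd m cov by blast
  then show ?thesis
  proof cases
    case PQ
    have "f ` bdry lo hi \<subseteq> A \<inter> B" using f(2,3) PQ bs by (force simp: image_subset_iff)
    moreover have "fillable p (A \<inter> B)" using fAB PQ by blast
    ultimately obtain F where F: "continuous_on (cell lo hi) F" "F ` cell lo hi \<subseteq> A \<inter> B"
      "\<forall>t\<in>bdry lo hi. F t = f t" using fill by meson
    then show ?thesis by (intro exI[of _ F]) (auto simp: image_subset_iff)
  next
    case P
    have "f ` bdry lo hi \<subseteq> A" using f(2) P bs by (force simp: image_subset_iff)
    from fill[OF fA this] obtain F where F: "continuous_on (cell lo hi) F" "F ` cell lo hi \<subseteq> A"
      "\<forall>t\<in>bdry lo hi. F t = f t" by blast
    moreover have "F ` (cell lo hi \<inter> Q) \<subseteq> B" using F P f(3) by force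
    ultimately show ?thesis by blast
  next
    case Q
    have "f ` bdry lo hi \<subseteq> B" using f(3) Q bs by (force simp: image_subset_iff)
    from fill[OF fB this] obtain F where F: "continuous_on (cell lo hi) F" "F ` cell lo hi \<subseteq> B"
      "\<forall>t\<in>bdry lo hi. F t = f t" by blast
    moreover have "F ` (cell lo hi \<inter> P) \<subseteq> A" using F Q f(2) by force
    ultimately show ?thesis by blast
  qed
qed

lemma paste:
  assumes "closed S" "closed T" "continuous_on S f" "continuous_on T g"
    and "\<And>x. x \<in> S \<Longrightarrow> x \<in> T \<Longrightarrow> f x = g x"
  shows "continuous_on (S \<union> T) (\<lambda>x. if x \<in> S then f x else g x)"
  using assms by (intro continuous_on_cases) auto

lemma cell_upper:
  assumes "x \<le> hi i"
  shows "cell lo (hi(i := x)) = {t \<in> cell lo hi. t i \<le> x}"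
proof (intro set_eqI iffI)
  fix t assume t: "t \<in> cell lo (hi(i := x))"
  have "lo j \<le> t j \<and> t j \<le> hi j" for j
    using t assms by (cases "j = i") (auto simp: cell_def dest!: spec[of _ j])
  moreover have "t i \<le> x" using t by (auto simp: cell_def dest!: spec[of _ i])
  ultimately show "t \<in> {t \<in> cell lo hi. t i \<le> x}" by (simp add: cell_def)
qed (auto simp: cell_def)

lemma cell_lower:
  assumes "lo i \<le> x"
  shows "cell (lo(i := x)) hi = {t \<in> cell lo hi. x \<le> t i}"
proof (intro set_eqI iffI)
  fix t assume t: "t \<in> cell (lo(i := x)) hi"
  have "lo j \<le> t j \<and> t j \<le> hi j" for j
    using t assms by (cases "j = i") (auto simp: cell_def dest!: spec[of _ j])
  moreover have "x \<le> t i" using t by (auto simp: cell_def dest!: spec[of _ i])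
  ultimately show "t \<in> {t \<in> cell lo hi. x \<le> t i}" by (simp add: cell_def)
qed (auto simp: cell_def)

text \<open>Induction on the number of cuts through the box: fill the common face of the two halves first,
  then each half.\<close>

lemma fill_carried:
  assumes Cu: "finite Cu" and P: "adapted Cu P" and Q: "adapted Cu Q"
    and cov: "cell lo hi \<subseteq> P \<union> Q" and c: "is_cell p lo hi"
    and f: "continuous_on (bdry lo hi) f" "f ` (bdry lo hi \<inter> P) \<subseteq> A" "f ` (bdry lo hi \<inter> Q) \<subseteq> B"
    and fA: "\<And>p'. p' \<le> p \<Longrightarrow> fillable p' A" and fB: "\<And>p'. p' \<le> p \<Longrightarrow> fillable p' B"
    and fAB: "\<And>p' lo' hi'. atomic Cu lo' hi' \<Longrightarrow> is_cell p' lo' hi' \<Longrightarrow> cell lo' hi' \<subseteq> cell lo hi \<Longrightarrow>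
        cell lo' hi' \<subseteq> P \<inter> Q \<Longrightarrow> fillable p' (A \<inter> B)"
  shows "\<exists>F. continuous_on (cell lo hi) F \<and> F ` (cell lo hi \<inter> P) \<subseteq> A \<and> F ` (cell lo hi \<inter> Q) \<subseteq> B \<and>
           (\<forall>t\<in>bdry lo hi. F t = f t)"
  using cov c f fA fB fAB
proof (induction "card {(i, x)\<in>Cu. lo i < x \<and> x < hi i}" arbitrary: lo hi p f rule: less_induct)
  case less
  note cov = less.prems(1) and c = less.prems(2) and f = less.prems(3-5)
  note fA = less.prems(6) and fB = less.prems(7) and fAB = less.prems(8)
  show ?case
  proof (cases "atomic Cu lo hi")
    case True
    show ?thesis
      by (rule fill_atomic[OF True P Q cov c f fA fB fAB[OF True c]]) auto
  next
    case False
    then obtain i x where ix: "(i, x) \<in> Cu" "lo i < x" "x < hi i"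
      by (auto simp: atomic_def)
    \<comment> \<open>The hyperplane of the cut splits the box into a lower half
      \<open>cell lo h1\<close> and an upper half \<open>cell l2 hi\<close>; their common face
      \<open>cell l2 h1\<close> has one direction fewer.\<close>
    define h1 l2 where "h1 = hi(i := x)" and "l2 = lo(i := x)"
    have le: "lo j \<le> hi j" for j using c by (auto simp: is_cell_def)
    have fin: "finite (dirs lo hi)" and card: "card (dirs lo hi) = p" using c by (auto simp: is_cell_def)
    have d1: "dirs lo h1 = dirs lo hi" and d2: "dirs l2 hi = dirs lo hi"
      and d0: "dirs l2 h1 = dirs lo hi - {i}"
      using ix by (auto simp: dirs_def h1_def l2_def split: if_splits)
    have i: "i \<in> dirs lo hi" using ix by (auto simp: dirs_def)
    have c1: "is_cell p lo h1" and c2: "is_cell p l2 hi" and c0: "is_cell (p - 1) l2 h1"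
      using le ix fin card i by (auto simp: is_cell_def d1 d2 d0, auto simp: h1_def l2_def)
    have e1: "cell lo h1 = {t \<in> cell lo hi. t i \<le> x}"
      using ix unfolding h1_def by (intro cell_upper) auto
    have e2: "cell l2 hi = {t \<in> cell lo hi. x \<le> t i}"
      using ix unfolding l2_def by (intro cell_lower) auto
    have e0: "cell l2 h1 = {t \<in> cell lo hi. t i = x}"
      using cell_lower[of lo i x h1] ix e1 by (auto simp: l2_def h1_def)
    have u: "h1 i = x" "l2 i = x" "\<And>j. j \<noteq> i \<Longrightarrow> h1 j = hi j" "\<And>j. j \<noteq> i \<Longrightarrow> l2 j = lo j"
      by (auto simp: h1_def l2_def)
    \<comment> \<open>Direction i is degenerate on the face, and x lies strictly between
      \<open>lo i\<close> and \<open>hi i\<close>, so i contributes no boundary point on either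
      side.\<close>
    have b0: "bdry l2 h1 = bdry lo hi \<inter> cell l2 h1"
    proof (intro set_eqI iffI)
      fix t assume "t \<in> bdry l2 h1"
      then obtain j where "t \<in> cell l2 h1" "j \<in> dirs lo hi" "j \<noteq> i" "t j = l2 j \<or> t j = h1 j"
        unfolding bdry_def d0 by blast
      then show "t \<in> bdry lo hi \<inter> cell l2 h1" using e0 u unfolding bdry_def by auto
    next
      fix t assume "t \<in> bdry lo hi \<inter> cell l2 h1"
      then obtain j where j: "t \<in> cell l2 h1" "j \<in> dirs lo hi" "t j = lo j \<or> t j = hi j"
        unfolding bdry_def by blast
      moreover have "j \<noteq> i" using j ix unfolding e0 by auto
      ultimately show "t \<in> bdry l2 h1" using u unfolding bdry_def d0 by auto
    qed
    have b1: "bdry lo h1 \<subseteq> bdry lo hi \<union> cell l2 h1"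
    proof
      fix t assume "t \<in> bdry lo h1"
      then obtain j where "t \<in> cell lo h1" "j \<in> dirs lo hi" "t j = lo j \<or> t j = h1 j"
        unfolding bdry_def d1 by blast
      then show "t \<in> bdry lo hi \<union> cell l2 h1"
        using u unfolding e0 e1 bdry_def by (cases "j = i") auto
    qed
    have b2: "bdry l2 hi \<subseteq> bdry lo hi \<union> cell l2 h1"
    proof
      fix t assume "t \<in> bdry l2 hi"
      then obtain j where "t \<in> cell l2 hi" "j \<in> dirs lo hi" "t j = l2 j \<or> t j = hi j"
        unfolding bdry_def d2 by blast
      then show "t \<in> bdry lo hi \<union> cell l2 h1"
        using u unfolding e0 e2 bdry_def by (cases "j = i") auto
    qed
    have bb1: "bdry lo hi \<inter> cell lo h1 \<subseteq> bdry lo h1"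
    proof
      fix t assume "t \<in> bdry lo hi \<inter> cell lo h1"
      then obtain j where j: "t \<in> cell lo h1" "j \<in> dirs lo hi" "t j = lo j \<or> t j = hi j"
        unfolding bdry_def by blast
      moreover have "t j = lo j \<or> t j = h1 j" using j ix u unfolding e1 by (cases "j = i") auto
      ultimately show "t \<in> bdry lo h1" unfolding bdry_def d1 by blast
    qed
    have bb2: "bdry lo hi \<inter> cell l2 hi \<subseteq> bdry l2 hi"
    proof
      fix t assume "t \<in> bdry lo hi \<inter> cell l2 hi"
      then obtain j where j: "t \<in> cell l2 hi" "j \<in> dirs lo hi" "t j = lo j \<or> t j = hi j"
        unfolding bdry_def by blast
      moreover have "t j = l2 j \<or> t j = hi j" using j ix u unfolding e2 by (cases "j = i") auto
      ultimately show "t \<in> bdry l2 hi" unfolding bdry_def d2 by blast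
    qed
    let ?n = "\<lambda>lo hi. card {(i, x)\<in>Cu. lo i < x \<and> x < hi i}"
    have finn: "finite {(i, x)\<in>Cu. lo i < x \<and> x < hi i}" using Cu by (rule rev_finite_subset) auto
    have less_n: "?n lo' hi' < ?n lo hi"
      if "\<And>j. lo j \<le> lo' j" "\<And>j. hi' j \<le> hi j" "x \<le> lo' i \<or> hi' i \<le> x" for lo' hi'
    proof (rule psubset_card_mono[OF finn])
      have "{(i, x)\<in>Cu. lo' i < x \<and> x < hi' i} \<subseteq> {(i, x)\<in>Cu. lo i < x \<and> x < hi i}"
        using that(1,2) by (auto intro: le_less_trans less_le_trans)
      moreover have "(i, x) \<in> {(i, x)\<in>Cu. lo i < x \<and> x < hi i}" using ix by auto
      moreover have "(i, x) \<notin> {(i, x)\<in>Cu. lo' i < x \<and> x < hi' i}" using that(3) by auto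
      ultimately show "{(i, x)\<in>Cu. lo' i < x \<and> x < hi' i} \<subset> {(i, x)\<in>Cu. lo i < x \<and> x < hi i}"
        by blast
    qed
    have n0: "?n l2 h1 < ?n lo hi" and n1: "?n lo h1 < ?n lo hi" and n2: "?n l2 hi < ?n lo hi"
      by (rule less_n; use ix in \<open>auto simp: h1_def l2_def\<close>)+
    have s: "cell l2 h1 \<subseteq> cell lo hi" "cell lo h1 \<subseteq> cell lo hi" "cell l2 hi \<subseteq> cell lo hi"
      unfolding e0 e1 e2 by auto
    have "\<exists>F. continuous_on (cell l2 h1) F \<and> F ` (cell l2 h1 \<inter> P) \<subseteq> A \<and> F ` (cell l2 h1 \<inter> Q) \<subseteq> B \<and>
           (\<forall>t\<in>bdry l2 h1. F t = f t)"
    proof (rule less.hyps[OF n0 _ c0])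
      show "cell l2 h1 \<subseteq> P \<union> Q" using s cov by blast
      show "continuous_on (bdry l2 h1) f" using f(1) b0 by (auto intro: continuous_on_subset)
      show "f ` (bdry l2 h1 \<inter> P) \<subseteq> A" "f ` (bdry l2 h1 \<inter> Q) \<subseteq> B" using f b0 by blast+
      show "fillable p' (A \<inter> B)" if "atomic Cu lo' hi'" "is_cell p' lo' hi'" "cell lo' hi' \<subseteq> cell l2 h1"
        "cell lo' hi' \<subseteq> P \<inter> Q" for p' lo' hi'
        using fAB that s by blast
    qed (use fA fB in auto)
    then obtain F0 where F0: "continuous_on (cell l2 h1) F0" "F0 ` (cell l2 h1 \<inter> P) \<subseteq> A"
      "F0 ` (cell l2 h1 \<inter> Q) \<subseteq> B" "\<forall>t\<in>bdry l2 h1. F0 t = f t" by blast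
    \<comment> \<open>The boundary data for both halves: the given map on the outer boundary and the
      filling of the common face.\<close>
    define g where "g = (\<lambda>t. if t \<in> bdry lo hi then f t else F0 t)"
    have g0: "g t = F0 t" if "t \<in> cell l2 h1" for t
      using that F0(4) b0 by (auto simp: g_def)
    have gb: "g t = f t" if "t \<in> bdry lo hi" for t
      using that by (auto simp: g_def)
    have gc: "continuous_on (bdry lo hi \<union> cell l2 h1) g"
      unfolding g_def using f(1) F0(1,4) b0 closed_bdry[OF fin] closed_cell
      by (intro paste) auto
    have gA: "g ` ((bdry lo hi \<union> cell l2 h1) \<inter> P) \<subseteq> A"
      and gB: "g ` ((bdry lo hi \<union> cell l2 h1) \<inter> Q) \<subseteq> B"
      using g0 gb f F0 by (auto simp: image_subset_iff)
    have "\<exists>F. continuous_on (cell lo h1) F \<and> F ` (cell lo h1 \<inter> P) \<subseteq> A \<and> F ` (cell lo h1 \<inter> Q) \<subseteq> B \<and>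
           (\<forall>t\<in>bdry lo h1. F t = g t)"
    proof (rule less.hyps[OF n1 _ c1])
      show "cell lo h1 \<subseteq> P \<union> Q" using s cov by blast
      show "continuous_on (bdry lo h1) g" using gc b1 by (rule continuous_on_subset)
      show "g ` (bdry lo h1 \<inter> P) \<subseteq> A" "g ` (bdry lo h1 \<inter> Q) \<subseteq> B" using gA gB b1 by blast+
      show "fillable p' (A \<inter> B)" if "atomic Cu lo' hi'" "is_cell p' lo' hi'" "cell lo' hi' \<subseteq> cell lo h1"
        "cell lo' hi' \<subseteq> P \<inter> Q" for p' lo' hi'
        using fAB that s by blast
    qed (use fA fB in auto)
    then obtain F1 where F1: "continuous_on (cell lo h1) F1" "F1 ` (cell lo h1 \<inter> P) \<subseteq> A"
      "F1 ` (cell lo h1 \<inter> Q) \<subseteq> B" "\<forall>t\<in>bdry lo h1. F1 t = g t" by blast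
    have "\<exists>F. continuous_on (cell l2 hi) F \<and> F ` (cell l2 hi \<inter> P) \<subseteq> A \<and> F ` (cell l2 hi \<inter> Q) \<subseteq> B \<and>
           (\<forall>t\<in>bdry l2 hi. F t = g t)"
    proof (rule less.hyps[OF n2 _ c2])
      show "cell l2 hi \<subseteq> P \<union> Q" using s cov by blast
      show "continuous_on (bdry l2 hi) g" using gc b2 by (rule continuous_on_subset)
      show "g ` (bdry l2 hi \<inter> P) \<subseteq> A" "g ` (bdry l2 hi \<inter> Q) \<subseteq> B" using gA gB b2 by blast+
      show "fillable p' (A \<inter> B)" if "atomic Cu lo' hi'" "is_cell p' lo' hi'" "cell lo' hi' \<subseteq> cell l2 hi"
        "cell lo' hi' \<subseteq> P \<inter> Q" for p' lo' hi'
        using fAB that s by blast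
    qed (use fA fB in auto)
    then obtain F2 where F2: "continuous_on (cell l2 hi) F2" "F2 ` (cell l2 hi \<inter> P) \<subseteq> A"
      "F2 ` (cell l2 hi \<inter> Q) \<subseteq> B" "\<forall>t\<in>bdry l2 hi. F2 t = g t" by blast
    define F where "F = (\<lambda>t. if t \<in> cell lo h1 then F1 t else F2 t)"
    have un: "cell lo hi = cell lo h1 \<union> cell l2 hi" unfolding e1 e2 by auto
    \<comment> \<open>The halves meet in a part of both their boundaries, where either filling
      equals \<open>g\<close>.\<close>
    have "t \<in> bdry lo h1 \<and> t \<in> bdry l2 hi" if t: "t \<in> cell lo h1" "t \<in> cell l2 hi" for t
    proof -
      have "t i = h1 i" "t i = l2 i" using t u unfolding e1 e2 by auto
      then show ?thesis using t i unfolding bdry_def d1 d2 by blast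
    qed
    then have agree: "F1 t = F2 t" if "t \<in> cell lo h1" "t \<in> cell l2 hi" for t
      using that F1(4) F2(4) by metis
    have "continuous_on (cell lo hi) F"
      unfolding F_def un using agree F1(1) F2(1) closed_cell by (intro paste) auto
    moreover have "F ` (cell lo hi \<inter> P) \<subseteq> A" "F ` (cell lo hi \<inter> Q) \<subseteq> B"
      using F1(2,3) F2(2,3) unfolding un F_def by (auto simp: image_subset_iff)
    moreover have "\<forall>t\<in>bdry lo hi. F t = f t"
      using F1(4) F2(4) gb bb1 bb2 un bdry_subset_cell unfolding F_def by (auto simp: subset_iff)
    ultimately show ?thesis by blast
  qed
qed

section \<open>Gluing two open sets\<close>

lemma adapted_Union:
  assumes "\<And>X. X \<in> \<X> \<Longrightarrow> adapted Cu X"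
  shows "adapted Cu (\<Union>\<X>)"
  unfolding adapted_def
proof (intro allI impI)
  fix lo hi assume "atomic Cu lo hi"
  then have "cell lo hi \<subseteq> X \<or> cell lo hi \<inter> X \<subseteq> bdry lo hi" if "X \<in> \<X>" for X
    using assms[OF that] by (simp add: adapted_def)
  then show "cell lo hi \<subseteq> \<Union>\<X> \<or> cell lo hi \<inter> \<Union>\<X> \<subseteq> bdry lo hi" by blast
qed

section \<open>Grid subdivision of a box and its Lebesgue property\<close>

definition grid :: "(nat \<Rightarrow> real) \<Rightarrow> (nat \<Rightarrow> real) \<Rightarrow> nat \<Rightarrow> nat \<Rightarrow> nat \<Rightarrow> real" where
  "grid lo hi N i k = lo i + real k * ((hi i - lo i) / real N)"

text \<open>Blocks are not bounded in the degenerate directions: this keeps the set of cuts finite.\<close>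

definition block :: "(nat \<Rightarrow> real) \<Rightarrow> (nat \<Rightarrow> real) \<Rightarrow> nat \<Rightarrow> (nat \<Rightarrow> nat) \<Rightarrow> (nat \<Rightarrow> real) set" where
  "block lo hi N z =
     {t. \<forall>i\<in>dirs lo hi. grid lo hi N i (z i) \<le> t i \<and> t i \<le> grid lo hi N i (Suc (z i))}"

definition cuts :: "(nat \<Rightarrow> real) \<Rightarrow> (nat \<Rightarrow> real) \<Rightarrow> nat \<Rightarrow> (nat \<times> real) set" where
  "cuts lo hi N = (\<lambda>(i, k). (i, grid lo hi N i k)) ` (dirs lo hi \<times> {..N})"

lemma grid_mono: "i \<in> dirs lo hi \<Longrightarrow> k \<le> l \<Longrightarrow> grid lo hi N i k \<le> grid lo hi N i l"
  unfolding grid_def dirs_def by (intro add_left_mono mult_right_mono) auto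

lemma cutsI: "i \<in> dirs lo hi \<Longrightarrow> k \<le> N \<Longrightarrow> (i, grid lo hi N i k) \<in> cuts lo hi N"
  by (force simp: cuts_def)

lemma atomicD: "atomic Cu lo hi \<Longrightarrow> (i, x) \<in> Cu \<Longrightarrow> lo i < x \<Longrightarrow> hi i \<le> x"
  by (force simp: atomic_def)

text \<open>A point t of the block inside the box but off its boundary decides everything: where the
  box is degenerate, all its points share the coordinate of t; elsewhere t lies strictly between the
  ends of the box, and the cuts at the two ends of the block, which cannot fall inside, must enclose
  the whole side. The bound \<open>z i < N\<close> makes both ends of the block cuts.\<close>

lemma adapted_block:
  assumes "\<And>i. z i < N"
  shows "adapted (cuts lo hi N) (block lo hi N z)"
  unfolding adapted_def
proof (intro allI impI)
  fix lo' hi' assume at: "atomic (cuts lo hi N) lo' hi'"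
  show "cell lo' hi' \<subseteq> block lo hi N z \<or> cell lo' hi' \<inter> block lo hi N z \<subseteq> bdry lo' hi'"
  proof (rule disjCI)
    assume "\<not> cell lo' hi' \<inter> block lo hi N z \<subseteq> bdry lo' hi'"
    then obtain t where t: "t \<in> cell lo' hi'" "t \<in> block lo hi N z" "t \<notin> bdry lo' hi'" by blast
    have "grid lo hi N i (z i) \<le> u i \<and> u i \<le> grid lo hi N i (Suc (z i))"
      if u: "u \<in> cell lo' hi'" and i: "i \<in> dirs lo hi" for u i
    proof -
      have ui: "lo' i \<le> u i" "u i \<le> hi' i" and ti: "lo' i \<le> t i" "t i \<le> hi' i"
        using u t(1) by (auto simp: cell_def)
      have tb: "grid lo hi N i (z i) \<le> t i" "t i \<le> grid lo hi N i (Suc (z i))"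
        using t(2) i by (auto simp: block_def)
      show ?thesis
      proof (cases "lo' i < hi' i")
        case False
        then have "u i = t i" using ui ti by linarith
        then show ?thesis using tb by simp
      next
        case True
        then have "t i \<noteq> lo' i" "t i \<noteq> hi' i" using t by (auto simp: bdry_def dirs_def)
        then have ti: "lo' i < t i" "t i < hi' i" using ti by auto
        have "z i \<le> N" "Suc (z i) \<le> N" using assms[of i] by auto
        note cut = this[THEN cutsI[OF i], THEN atomicD[OF at]]
        have "hi' i \<le> grid lo hi N i (Suc (z i))" using ti tb by (intro cut) linarith
        moreover have "grid lo hi N i (z i) \<le> lo' i"
          using cut(1) ti tb by (cases "lo' i < grid lo hi N i (z i)") linarith+
        ultimately show ?thesis using ui by linarith
      qed
    qed
    then show "cell lo' hi' \<subseteq> block lo hi N z" by (auto simp: block_def)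
  qed
qed

lemma between_steps:
  fixes x :: "nat \<Rightarrow> real"
  shows "x 0 \<le> t \<Longrightarrow> t \<le> x (Suc M) \<Longrightarrow> \<exists>k\<le>M. x k \<le> t \<and> t \<le> x (Suc k)"
proof (induction M)
  case (Suc M)
  show ?case
  proof (cases "t \<le> x (Suc M)")
    case True then show ?thesis using Suc le_SucI by blast
  next
    case False then show ?thesis using Suc by (intro exI[of _ "Suc M"]) auto
  qed
qed auto

lemma blocks_cover:
  assumes N: "N > 0" and t: "t \<in> cell lo hi"
  shows "\<exists>z. (\<forall>i. z i < N) \<and> t \<in> block lo hi N z"
proof -
  obtain M where M: "N = Suc M" using N by (cases N) auto
  have "\<exists>k\<le>M. grid lo hi N i k \<le> t i \<and> t i \<le> grid lo hi N i (Suc k)" for i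
    using t unfolding M by (intro between_steps) (auto simp: grid_def cell_def simp del: of_nat_Suc)
  then obtain z where "\<And>i. z i \<le> M \<and> grid lo hi N i (z i) \<le> t i \<and> t i \<le> grid lo hi N i (Suc (z i))"
    by metis
  then show ?thesis unfolding M by (intro exI[of _ z]) (auto simp: block_def less_Suc_eq_le)
qed

text \<open>If the two indices differ in a direction of the big box, that coordinate of
  \<open>m\<close> is a grid value and hence a cut. An atom having all directions of the big box is
  not degenerate there, so its interior point \<open>m\<close> avoids every cut.\<close>

lemma top_atom_in_unique_block:
  assumes at: "atomic (cuts lo hi N) lo' hi'" and d: "dirs lo' hi' = dirs lo hi"
    and z: "\<And>i. z i < N" and z': "\<And>i. z' i < N"
    and m: "m \<in> block lo hi N z" "m \<in> block lo hi N z'" "m \<in> cell lo' hi' - bdry lo' hi'"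
  shows "block lo hi N z = block lo hi N z'"
proof -
  have key: "\<not> a i < b i" if i: "i \<in> dirs lo hi" and ab: "m \<in> block lo hi N a" "m \<in> block lo hi N b" "b i < N"
    for a b i
  proof
    assume "a i < b i"
    then have "m i \<le> grid lo hi N i (b i)"
      using ab(1) grid_mono[OF i, of "Suc (a i)" "b i" N] i by (force simp: block_def)
    moreover have "grid lo hi N i (b i) \<le> m i" using ab(2) i by (auto simp: block_def)
    ultimately have e: "m i = grid lo hi N i (b i)" by simp
    have "lo' i \<le> m i" "m i \<le> hi' i" "m i \<noteq> lo' i" "m i \<noteq> hi' i"
      using m(3) i d by (auto simp: cell_def bdry_def)
    then show False
      using atomicD[OF at cutsI[OF i, of "b i" N]] ab(3) unfolding e by auto
  qed
  have "z i = z' i" if "i \<in> dirs lo hi" for i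
    using key[OF that m(1,2) z'] key[OF that m(2,1) z] by linarith
  then show ?thesis by (auto simp: block_def)
qed

text \<open>This is the Lebesgue number lemma for the cover of the boundary by the sets where
  \<open>g < 1\<close> and where \<open>0 < g\<close>. If every grid fails, there are points
  \<open>u n\<close> and \<open>w n\<close> in a common block with \<open>g\<close> at least 1 and
  at most 0 respectively; their coordinates approach each other, and compactness gives a common
  limit at which both bounds would hold.\<close>

lemma lebesgue_blocks:
  fixes g :: "(nat \<Rightarrow> real) \<Rightarrow> real"
  assumes le: "\<forall>i. lo i \<le> hi i" and fin: "finite (dirs lo hi)" and g: "continuous_on (bdry lo hi) g"
  shows "\<exists>N>0. \<forall>z. (\<forall>t\<in>block lo hi N z \<inter> bdry lo hi. g t < 1) \<or>
           (\<forall>t\<in>block lo hi N z \<inter> bdry lo hi. 0 < g t)"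
proof (rule ccontr)
  assume "\<not> ?thesis"
  then have "\<exists>z u w. u \<in> block lo hi (Suc n) z \<inter> bdry lo hi \<and> w \<in> block lo hi (Suc n) z \<inter> bdry lo hi \<and>
      1 \<le> g u \<and> g w \<le> 0" for n
    by (metis not_le zero_less_Suc)
  then obtain z u w where zuw: "\<And>n. u n \<in> block lo hi (Suc n) (z n) \<inter> bdry lo hi"
    "\<And>n. w n \<in> block lo hi (Suc n) (z n) \<inter> bdry lo hi" "\<And>n. 1 \<le> g (u n)" "\<And>n. g (w n) \<le> 0"
    by metis
  have close: "\<bar>u n i - w n i\<bar> \<le> (hi i - lo i) / real (Suc n)" for n i
  proof (cases "i \<in> dirs lo hi")
    case True
    have "grid lo hi (Suc n) i (Suc (z n i)) - grid lo hi (Suc n) i (z n i) = (hi i - lo i) / real (Suc n)"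
      unfolding grid_def of_nat_Suc[of "z n i"] distrib_right by simp
    then show ?thesis using zuw(1,2)[of n] True by (force simp: block_def)
  next
    case False
    moreover have "u n \<in> cell lo hi" "w n \<in> cell lo hi" using zuw(1,2)[of n] by (auto simp: bdry_def)
    ultimately have "u n i = w n i" using le[rule_format, of i] unfolding cell_def dirs_def
      by (auto dest!: spec[of _ i])
    then show ?thesis using le by simp
  qed
  have cb: "compact (bdry lo hi)"
    using closed_bdry[OF fin] compact_cell[of lo hi] bdry_subset_cell
    by (metis compact_Int_closed inf.absorb2)
  then have sc: "seq_compact (bdry lo hi)" by (rule compact_imp_seq_compact)
  obtain l r where l: "l \<in> bdry lo hi" "strict_mono r" "(u \<circ> r) \<longlonglongrightarrow> l"
    using sc zuw(1) unfolding seq_compact_def by blast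
  obtain l' r' where l': "l' \<in> bdry lo hi" "strict_mono r'" "((w \<circ> r) \<circ> r') \<longlonglongrightarrow> l'"
    using sc[unfolded seq_compact_def, rule_format, of "w \<circ> r"] zuw(2) by auto
  define q where "q = r \<circ> r'"
  have q: "strict_mono q" using l l' by (simp add: q_def strict_mono_o)
  have uq: "(\<lambda>n. u (q n)) \<longlonglongrightarrow> l"
    using LIMSEQ_subseq_LIMSEQ[OF l(3) l'(2)] by (simp add: q_def o_def)
  have wq: "(\<lambda>n. w (q n)) \<longlonglongrightarrow> l'"
    using l'(3) by (simp add: q_def o_def)
  have "l i = l' i" for i
  proof -
    have "(\<lambda>n. u (q n) i) \<longlonglongrightarrow> l i" "(\<lambda>n. w (q n) i) \<longlonglongrightarrow> l' i"
      using continuous_on_tendsto_compose[OF continuous_on_coord[of UNIV i], OF uq]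
        continuous_on_tendsto_compose[OF continuous_on_coord[of UNIV i], OF wq] by auto
    then have "(\<lambda>n. u (q n) i - w (q n) i) \<longlonglongrightarrow> l i - l' i" by (rule tendsto_diff)
    moreover have "(\<lambda>n. u (q n) i - w (q n) i) \<longlonglongrightarrow> 0"
    proof (rule Lim_null_comparison)
      show "\<forall>\<^sub>F n in sequentially. norm (u (q n) i - w (q n) i) \<le> (hi i - lo i) / real (Suc (q n))"
        using close by simp
      have "(\<lambda>n. (hi i - lo i) / real (Suc n)) \<longlonglongrightarrow> 0"
        using LIMSEQ_Suc[OF lim_const_over_n[of "hi i - lo i"]] .
      from LIMSEQ_subseq_LIMSEQ[OF this q]
      show "(\<lambda>n. (hi i - lo i) / real (Suc (q n))) \<longlonglongrightarrow> 0" by (simp add: o_def)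
    qed
    ultimately have "l i - l' i = 0" using LIMSEQ_unique by blast
    then show ?thesis by simp
  qed
  then have ll: "l' = l" by auto
  have "(\<lambda>n. g (u (q n))) \<longlonglongrightarrow> g l"
    using zuw(1) by (intro continuous_on_tendsto_compose[OF g uq l(1)]) auto
  then have "1 \<le> g l" using zuw(3) by (intro LIMSEQ_le_const) auto
  moreover have "(\<lambda>n. g (w (q n))) \<longlonglongrightarrow> g l"
    using zuw(2) wq ll by (intro continuous_on_tendsto_compose[OF g _ l(1)]) auto
  then have "g l \<le> 0" using zuw(4) by (intro LIMSEQ_le_const2) auto
  ultimately show False by simp
qed

text \<open>Each block of a fine grid is assigned to one of the two open sets. A box inside blocks of both
  kinds has lower dimension, so the intersection needs to be fillable below p only.\<close>

lemma fillable_union: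
  fixes \<phi> :: "'a::topological_space \<Rightarrow> real"
  assumes \<phi>: "continuous_on U \<phi>"
    and A: "\<And>p'. p' \<le> p \<Longrightarrow> fillable p' {x\<in>U. \<phi> x < 1}"
    and B: "\<And>p'. p' \<le> p \<Longrightarrow> fillable p' {x\<in>U. 0 < \<phi> x}"
    and AB: "\<And>p'. p' < p \<Longrightarrow> fillable p' {x\<in>U. 0 < \<phi> x \<and> \<phi> x < 1}"
  shows "fillable p U"
  unfolding fillable_def
proof (intro allI impI, elim conjE)
  fix lo hi f
  assume c: "is_cell p lo hi" and f: "continuous_on (bdry lo hi) f" and fU: "f ` bdry lo hi \<subseteq> U"
  let ?A = "{x\<in>U. \<phi> x < 1}" and ?B = "{x\<in>U. 0 < \<phi> x}"
  have le: "\<forall>i. lo i \<le> hi i" and fin: "finite (dirs lo hi)" and card: "card (dirs lo hi) = p"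
    using c by (auto simp: is_cell_def)
  have "continuous_on (bdry lo hi) (\<lambda>t. \<phi> (f t))"
    by (rule continuous_on_compose2[OF \<phi> f fU])
  from lebesgue_blocks[OF le fin this] obtain N where N: "N > 0"
    and leb: "\<And>z. (\<forall>t\<in>block lo hi N z \<inter> bdry lo hi. \<phi> (f t) < 1) \<or>
           (\<forall>t\<in>block lo hi N z \<inter> bdry lo hi. 0 < \<phi> (f t))" by blast
  define blocks where "blocks = block lo hi N ` {z. \<forall>i. z i < N}"
  \<comment> \<open>A block that misses the boundary satisfies this vacuously and is assigned to
    \<open>P\<close>; only boundary values constrain the choice.\<close>
  define lab where "lab X \<longleftrightarrow> (\<forall>t\<in>X \<inter> bdry lo hi. \<phi> (f t) < 1)" for X
  define P where "P = \<Union>{X\<in>blocks. lab X}"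
  define Q where "Q = \<Union>{X\<in>blocks. \<not> lab X}"
  have ad: "adapted (cuts lo hi N) X" if "X \<in> blocks" for X
    using that adapted_block unfolding blocks_def by blast
  have cov: "\<exists>X\<in>blocks. t \<in> X" if "t \<in> cell lo hi" for t
    using blocks_cover[OF N that] unfolding blocks_def by blast
  have leb': "0 < \<phi> (f t)" if "X \<in> blocks" "\<not> lab X" "t \<in> X" "t \<in> bdry lo hi" for X t
  proof -
    from that(1) obtain z where "X = block lo hi N z" unfolding blocks_def by blast
    with leb[of z] that show ?thesis unfolding lab_def by blast
  qed
  have "\<exists>F. continuous_on (cell lo hi) F \<and> F ` (cell lo hi \<inter> P) \<subseteq> ?A \<and> F ` (cell lo hi \<inter> Q) \<subseteq> ?B \<and>
           (\<forall>t\<in>bdry lo hi. F t = f t)"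
  proof (rule fill_carried)
    show "finite (cuts lo hi N)" using fin by (simp add: cuts_def)
    show "adapted (cuts lo hi N) P" "adapted (cuts lo hi N) Q"
      unfolding P_def Q_def by (rule adapted_Union; simp add: ad)+
    show "cell lo hi \<subseteq> P \<union> Q"
      using cov unfolding P_def Q_def by fast
    show "is_cell p lo hi" "continuous_on (bdry lo hi) f" by fact+
    show "f ` (bdry lo hi \<inter> P) \<subseteq> ?A"
      using fU unfolding P_def lab_def by auto
    show "f ` (bdry lo hi \<inter> Q) \<subseteq> ?B"
      using fU leb' unfolding Q_def by auto
    show "fillable p' (?A \<inter> ?B)" if at: "atomic (cuts lo hi N) lo' hi'" and c': "is_cell p' lo' hi'"
      and sub: "cell lo' hi' \<subseteq> cell lo hi" and PQ: "cell lo' hi' \<subseteq> P \<inter> Q" for p' lo' hi'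
    proof -
      have le': "\<forall>i. lo' i \<le> hi' i" and card': "card (dirs lo' hi') = p'"
        using c' by (auto simp: is_cell_def)
      have "lo' \<in> cell lo' hi'" "hi' \<in> cell lo' hi'" using le' by (auto simp: cell_def)
      then have "lo' \<in> cell lo hi" "hi' \<in> cell lo hi" using sub by auto
      then have "lo i \<le> lo' i \<and> hi' i \<le> hi i" for i by (simp add: cell_def)
      then have "lo i < hi i" if "lo' i < hi' i" for i
        using that by (meson le_less_trans less_le_trans)
      then have d: "dirs lo' hi' \<subseteq> dirs lo hi"
        unfolding dirs_def by blast
      \<comment> \<open>The midpoint of a full-dimensional atom lies in one block only, and a block
        has only one label.\<close>
      have "p' \<noteq> p"
      proof
        assume "p' = p"
        then have d: "dirs lo' hi' = dirs lo hi"
          using card_subset_eq[OF fin d] card card' by simp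
        let ?m = "\<lambda>i. (lo' i + hi' i) / 2"
        have m: "?m \<in> cell lo' hi' - bdry lo' hi'" using le' by (rule midpoint_in_cell)
        then have "?m \<in> P" "?m \<in> Q" using PQ by auto
        then obtain z z' where z: "\<And>i. z i < N" "?m \<in> block lo hi N z" "lab (block lo hi N z)"
          "\<And>i. z' i < N" "?m \<in> block lo hi N z'" "\<not> lab (block lo hi N z')"
          unfolding P_def Q_def blocks_def by auto
        then show False using top_atom_in_unique_block[OF at d z(1,4,2,5) m] by simp
      qed
      moreover have "p' \<le> p" using card_mono[OF fin d] card card' by simp
      ultimately have "fillable p' {x\<in>U. 0 < \<phi> x \<and> \<phi> x < 1}" using AB by simp
      moreover have "?A \<inter> ?B = {x\<in>U. 0 < \<phi> x \<and> \<phi> x < 1}" by auto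
      ultimately show ?thesis by simp
    qed
  qed (use A B in auto)
  then obtain F where F: "continuous_on (cell lo hi) F" "F ` (cell lo hi \<inter> P) \<subseteq> ?A"
    "F ` (cell lo hi \<inter> Q) \<subseteq> ?B" "\<forall>t\<in>bdry lo hi. F t = f t" by blast
  moreover have "F ` cell lo hi \<subseteq> U"
  proof
    fix y assume "y \<in> F ` cell lo hi"
    then obtain t where t: "y = F t" "t \<in> cell lo hi" by blast
    with cov have "t \<in> P \<or> t \<in> Q" unfolding P_def Q_def by fast
    then show "y \<in> U" using F(2,3) t by auto
  qed
  ultimately show "\<exists>F. continuous_on (cell lo hi) F \<and> F ` cell lo hi \<subseteq> U \<and> (\<forall>t\<in>bdry lo hi. F t = f t)"
    by blast
qed

section \<open>Deletion and link of a vertex\<close>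

lemma continuous_on_Max_family:
  fixes h :: "'i \<Rightarrow> 'a::topological_space \<Rightarrow> real"
  assumes "finite J" "J \<noteq> {}" "\<And>i. i \<in> J \<Longrightarrow> continuous_on S (h i)"
  shows "continuous_on S (\<lambda>t. Max ((\<lambda>i. h i t) ` J))"
  using assms
proof (induction J rule: finite_ne_induct)
  case (insert i J)
  then have "continuous_on S (\<lambda>t. max (h i t) (Max ((\<lambda>i. h i t) ` J)))"
    by (intro continuous_on_max) auto
  then show ?case using insert by simp
qed simp

text \<open>S is deformed along segments to the image of S'. The filling in S' is put into the concentric cube
  of half the size, and the deformation into the collar around it.\<close>

lemma fillable_segment_transfer:
  fixes S :: "('v \<Rightarrow> real) set" and S' :: "'b::topological_space set"
  assumes r: "continuous_on S r" "r ` S \<subseteq> S'" and j: "continuous_on S' j" "j ` S' \<subseteq> S"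
    and seg: "\<And>x u. x \<in> S \<Longrightarrow> 0 \<le> u \<Longrightarrow> u \<le> 1 \<Longrightarrow> (\<lambda>v. (1 - u) * x v + u * j (r x) v) \<in> S"
    and S': "fillable p S'"
  shows "fillable p S"
  unfolding fillable_def
proof (intro allI impI, elim conjE)
  fix lo hi f
  assume c: "is_cell p lo hi" and f: "continuous_on (bdry lo hi) f" and fS: "f ` bdry lo hi \<subseteq> S"
  have le: "\<And>i. lo i \<le> hi i" and fin: "finite (dirs lo hi)"
    using c by (auto simp: is_cell_def)
  have "continuous_on (bdry lo hi) (\<lambda>t. r (f t))" "(\<lambda>t. r (f t)) ` bdry lo hi \<subseteq> S'"
    using continuous_on_compose2[OF r(1) f fS] r(2) fS by auto
  then obtain G where G: "continuous_on (cell lo hi) G" "G ` cell lo hi \<subseteq> S'"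
    "\<And>t. t \<in> bdry lo hi \<Longrightarrow> G t = r (f t)"
    using S'[unfolded fillable_def, rule_format, of lo hi "\<lambda>t. r (f t)"] c by auto
  have jG: "continuous_on (cell lo hi) (\<lambda>t. j (G t))" "\<And>t. t \<in> cell lo hi \<Longrightarrow> j (G t) \<in> S"
    using continuous_on_compose2[OF j(1) G(1,2)] j(2) G(2) by auto
  show "\<exists>F. continuous_on (cell lo hi) F \<and> F ` cell lo hi \<subseteq> S \<and> (\<forall>t\<in>bdry lo hi. F t = f t)"
  \<comment> \<open>A box of dimension 0 has no boundary and no collar; the maximum defining
    \<open>\<rho>\<close> in the other case needs at least one direction.\<close>
  proof (cases "dirs lo hi = {}")
    case True
    then have "bdry lo hi = {}" by (auto simp: bdry_def)
    then show ?thesis using jG by auto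
  next
    case ne: False
    define m where "m i = (lo i + hi i) / 2" for i
    define h where "h i = (hi i - lo i) / 2" for i
    \<comment> \<open>\<open>\<rho>\<close> is the maximum norm about the centre of the box, scaled
      to be 1 on the boundary, so that \<open>1/2\<close> bounds the concentric box of half size.
      Next, \<open>c\<close> doubles that box onto the full one, and \<open>\<pi>\<close> projects
      radially to the boundary; \<open>\<pi>\<close> matters only where \<open>\<rho>\<close> is at
      least 1/2, hence nonzero.\<close>
    define \<rho> where "\<rho> t = Max ((\<lambda>i. \<bar>t i - m i\<bar> / h i) ` dirs lo hi)" for t
    define c where "c t i = m i + 2 * (t i - m i)" for t :: "nat \<Rightarrow> real" and i
    define \<pi> where "\<pi> t i = m i + (t i - m i) / \<rho> t" for t :: "nat \<Rightarrow> real" and i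
    \<comment> \<open>Across the collar the weight \<open>2 - 2 * \<rho> t\<close> runs from 1 at
      the inner box to 0 at the outer boundary, where \<open>F\<close> becomes
      \<open>f\<close>.\<close>
    define F where "F t = (if \<rho> t \<le> 1/2 then j (G (c t))
      else (\<lambda>v. (1 - (2 - 2 * \<rho> t)) * f (\<pi> t) v + (2 - 2 * \<rho> t) * j (r (f (\<pi> t))) v))" for t
    have hpos: "h i > 0" if "i \<in> dirs lo hi" for i using that by (simp add: h_def dirs_def)
    have h0: "h i = 0" if "i \<notin> dirs lo hi" for i using that le[of i] by (simp add: h_def dirs_def)
    have cell_iff: "t \<in> cell lo hi \<longleftrightarrow> (\<forall>i. \<bar>t i - m i\<bar> \<le> h i)" for t
    proof -
      have "lo i \<le> t i \<and> t i \<le> hi i \<longleftrightarrow> \<bar>t i - m i\<bar> \<le> h i" for i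
        unfolding m_def h_def abs_le_iff by argo
      then show ?thesis by (simp add: cell_def)
    qed
    have bdry_iff: "t \<in> bdry lo hi \<longleftrightarrow> t \<in> cell lo hi \<and> (\<exists>i\<in>dirs lo hi. \<bar>t i - m i\<bar> = h i)" for t
    proof -
      have "t i = lo i \<or> t i = hi i \<longleftrightarrow> \<bar>t i - m i\<bar> = h i" for i
        using le[of i] unfolding m_def h_def by (auto simp: abs_if field_simps)
      then show ?thesis unfolding bdry_def by blast
    qed
    have \<rho>_ge: "\<bar>t i - m i\<bar> \<le> h i * \<rho> t" if "i \<in> dirs lo hi" for t i
    proof -
      have "\<bar>t i - m i\<bar> / h i \<le> \<rho> t" unfolding \<rho>_def using fin that by (intro Max_ge) auto
      then show ?thesis using hpos[OF that] by (simp add: field_simps)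
    qed
    have \<rho>_at: "\<exists>i\<in>dirs lo hi. \<bar>t i - m i\<bar> = h i * \<rho> t" for t
    proof -
      have "\<rho> t \<in> (\<lambda>i. \<bar>t i - m i\<bar> / h i) ` dirs lo hi"
        unfolding \<rho>_def using fin ne by (intro Max_in) auto
      then obtain i where "i \<in> dirs lo hi" "\<rho> t = \<bar>t i - m i\<bar> / h i" by blast
      then show ?thesis using hpos[of i] by (intro bexI[of _ i]) auto
    qed
    have \<rho>_le1: "\<rho> t \<le> 1" if "t \<in> cell lo hi" for t
    proof -
      obtain i where i: "i \<in> dirs lo hi" "\<bar>t i - m i\<bar> = h i * \<rho> t" using \<rho>_at by blast
      then have "h i * \<rho> t \<le> h i * 1" using that cell_iff by (metis mult.right_neutral)
      then show ?thesis using hpos[OF i(1)] by simp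
    qed
    have off: "t i = m i" if "t \<in> cell lo hi" "i \<notin> dirs lo hi" for t i
      using that cell_iff[of t] h0[OF that(2)] by (metis abs_le_zero_iff eq_iff_diff_eq_0)
    have c_in: "c t \<in> cell lo hi" if t: "t \<in> cell lo hi" "\<rho> t \<le> 1/2" for t
      unfolding cell_iff
    proof
      fix i
      show "\<bar>c t i - m i\<bar> \<le> h i"
      proof (cases "i \<in> dirs lo hi")
        case True
        have "h i * \<rho> t \<le> h i * (1/2)" using t(2) hpos[OF True] by (intro mult_left_mono) auto
        then show ?thesis using \<rho>_ge[OF True, of t] by (simp add: c_def abs_mult)
      qed (use off[OF t(1)] h0 in \<open>simp add: c_def\<close>)
    qed
    have \<pi>_in: "\<pi> t \<in> bdry lo hi" if t: "t \<in> cell lo hi" "1/2 \<le> \<rho> t" for t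
    proof -
      have "\<bar>\<pi> t i - m i\<bar> \<le> h i" for i
      proof (cases "i \<in> dirs lo hi")
        case True
        show ?thesis using \<rho>_ge[OF True, of t] t(2) by (simp add: \<pi>_def field_simps)
      qed (use off[OF t(1)] h0 in \<open>simp add: \<pi>_def\<close>)
      moreover obtain i where "i \<in> dirs lo hi" "\<bar>t i - m i\<bar> = h i * \<rho> t" using \<rho>_at by blast
      moreover from this have "\<bar>\<pi> t i - m i\<bar> = h i" using t(2) by (simp add: \<pi>_def)
      ultimately show ?thesis unfolding bdry_iff cell_iff by blast
    qed
    have \<rho>_cont: "continuous_on X \<rho>" for X
      unfolding \<rho>_def using fin ne hpos
      by (intro continuous_on_Max_family continuous_intros continuous_on_coord) force+
    have c_cont: "continuous_on X c" for X
      unfolding c_def by (intro continuous_on_coordinatewise_then_product continuous_intros continuous_on_coord)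
    have \<pi>_cont: "continuous_on {t \<in> cell lo hi. 1/2 \<le> \<rho> t} \<pi>"
      unfolding \<pi>_def
      by (intro continuous_on_coordinatewise_then_product continuous_intros continuous_on_coord \<rho>_cont) auto
    let ?Y = "{t \<in> cell lo hi. 1/2 \<le> \<rho> t}"
    have f\<pi>: "continuous_on ?Y (\<lambda>t. f (\<pi> t))"
      using \<pi>_in by (intro continuous_on_compose2[OF f \<pi>_cont]) auto
    have f\<pi>_S: "f (\<pi> t) \<in> S" if "t \<in> ?Y" for t using \<pi>_in fS that by auto
    have rf\<pi>: "continuous_on ?Y (\<lambda>t. r (f (\<pi> t)))"
      using f\<pi>_S by (intro continuous_on_compose2[OF r(1) f\<pi>]) auto
    have jrf\<pi>: "continuous_on ?Y (\<lambda>t. j (r (f (\<pi> t))))"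
      using f\<pi>_S r(2) by (intro continuous_on_compose2[OF j(1) rf\<pi>]) auto
    have "continuous_on (cell lo hi) F"
      unfolding F_def
    proof (rule continuous_on_cases_le)
      show "continuous_on {t \<in> cell lo hi. \<rho> t \<le> 1/2} (\<lambda>t. j (G (c t)))"
        using c_in by (intro continuous_on_compose2[OF jG(1) c_cont]) auto
      show "continuous_on ?Y
        (\<lambda>t v. (1 - (2 - 2 * \<rho> t)) * f (\<pi> t) v + (2 - 2 * \<rho> t) * j (r (f (\<pi> t))) v)"
        by (intro continuous_on_coordinatewise_then_product continuous_intros \<rho>_cont
            continuous_on_coord_comp[OF f\<pi>] continuous_on_coord_comp[OF jrf\<pi>])
      fix t assume t: "t \<in> cell lo hi" "\<rho> t = 1/2"
      \<comment> \<open>Dividing by 1/2 is doubling. The common value is a boundary point, and there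
        \<open>G\<close> is \<open>r\<close> after \<open>f\<close>.\<close>
      then have "\<pi> t = c t" by (intro ext) (simp only: \<pi>_def c_def, simp)
      then show "j (G (c t)) =
          (\<lambda>v. (1 - (2 - 2 * \<rho> t)) * f (\<pi> t) v + (2 - 2 * \<rho> t) * j (r (f (\<pi> t))) v)"
        using t G(3)[of "\<pi> t"] \<pi>_in[of t] unfolding t(2) by simp
    qed (rule \<rho>_cont)
    moreover have "F t \<in> S" if t: "t \<in> cell lo hi" for t
    proof (cases "\<rho> t \<le> 1/2")
      case True then show ?thesis using c_in[OF t] jG(2) by (simp add: F_def)
    next
      case False
      then show ?thesis
        using seg[OF f\<pi>_S[of t], of "2 - 2 * \<rho> t"] t \<rho>_le1[OF t] by (simp add: F_def)
    qed
    moreover have "F t = f t" if t: "t \<in> bdry lo hi" for t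
    proof -
      have tc: "t \<in> cell lo hi" using t bdry_subset_cell by blast
      obtain i where i: "i \<in> dirs lo hi" "\<bar>t i - m i\<bar> = h i" using t bdry_iff by blast
      then have "h i * 1 \<le> h i * \<rho> t" using \<rho>_ge[OF i(1), of t] by simp
      then have "\<rho> t = 1" using hpos[OF i(1)] \<rho>_le1[OF tc] by simp
      moreover from this have "\<pi> t = t" by (intro ext) (simp add: \<pi>_def)
      ultimately show ?thesis by (simp add: F_def)
    qed
    ultimately show ?thesis by blast
  qed
qed

lemma fillable_singleton: "fillable p {a}"
  unfolding fillable_def
proof (intro allI impI, elim conjE)
  fix lo hi :: "nat \<Rightarrow> real" and f assume f: "f ` bdry lo hi \<subseteq> {a}"
  show "\<exists>F. continuous_on (cell lo hi) F \<and> F ` cell lo hi \<subseteq> {a} \<and> (\<forall>t\<in>bdry lo hi. F t = f t)"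
    by (rule exI[of _ "\<lambda>_. a"]) (use f in \<open>auto simp: image_subset_iff\<close>)
qed

section \<open>Simplicial complexes in barycentric coordinates\<close>

definition realization :: "'v set set \<Rightarrow> ('v \<Rightarrow> real) set" where
  "realization K = {x. (\<forall>v. 0 \<le> x v) \<and> {v. x v \<noteq> 0} \<in> K \<and> (\<Sum>v | x v \<noteq> 0. x v) = 1}"

text \<open>\<open>V\<close> is only a finite container: its elements need not be vertices of
  \<open>K\<close>. Deletions and links can thus keep the same \<open>V\<close>, and coordinate sums
  always range over it.\<close>

definition complex_on :: "'v set \<Rightarrow> 'v set set \<Rightarrow> bool" where
  "complex_on V K \<longleftrightarrow> finite V \<and> K \<subseteq> Pow V \<and> (\<forall>A\<in>K. \<forall>B\<subseteq>A. B \<in> K)"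

definition deletion :: "'v \<Rightarrow> 'v set set \<Rightarrow> 'v set set" where
  "deletion v K = {A \<in> K. v \<notin> A}"

definition link :: "'v \<Rightarrow> 'v set set \<Rightarrow> 'v set set" where
  "link v K = {A. v \<notin> A \<and> insert v A \<in> K}"

text \<open>This yields (D - 2)-connectedness. The strict bound makes \<open>D = 0\<close> void, so
  the truncated \<open>D - 1\<close> for links needs no side condition.\<close>

definition fills_below :: "nat \<Rightarrow> 'v set set \<Rightarrow> bool" where
  "fills_below D K \<longleftrightarrow> (\<forall>p<D. fillable p (realization K))"

lemma complex_on_deletion: "complex_on V K \<Longrightarrow> complex_on V (deletion v K)"
  by (auto simp: complex_on_def deletion_def)

lemma complex_on_link: 
  assumes "complex_on V K" shows "complex_on V (link v K)"
  unfolding complex_on_def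
proof (intro conjI ballI allI impI)
  show "finite V" using assms by (simp add: complex_on_def)
  show "link v K \<subseteq> Pow V" using assms by (auto simp: complex_on_def link_def)
  fix A B assume "A \<in> link v K" "B \<subseteq> A"
  moreover from this have "insert v B \<subseteq> insert v A" by blast
  ultimately show "B \<in> link v K" using assms unfolding complex_on_def link_def by blast
qed

lemma realization_iff:
  assumes "complex_on V K"
  shows "x \<in> realization K \<longleftrightarrow> (\<forall>v. 0 \<le> x v) \<and> {v. x v \<noteq> 0} \<in> K \<and> sum x V = 1"
proof -
  have "sum x V = (\<Sum>v | x v \<noteq> 0. x v)" if "{v. x v \<noteq> 0} \<in> K"
    using that assms by (intro sum.mono_neutral_right) (auto simp: complex_on_def)
  then show ?thesis by (auto simp: realization_def)
qed

lemma in_realizationI: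
  assumes "complex_on V K" "\<And>v. 0 \<le> x v" "A \<in> K" "\<And>v. v \<notin> A \<Longrightarrow> x v = 0" "sum x V = 1"
  shows "x \<in> realization K"
proof -
  have "{v. x v \<noteq> 0} \<subseteq> A" using assms(4) by auto
  then have "{v. x v \<noteq> 0} \<in> K" using assms(1,3) by (auto simp: complex_on_def)
  then show ?thesis using realization_iff[OF assms(1)] assms by simp
qed

definition vertex_point :: "'v \<Rightarrow> 'v \<Rightarrow> real" where
  "vertex_point v = (\<lambda>w. if w = v then 1 else 0)"

text \<open>Radial projection from the vertex \<open>v\<close> onto the opposite face, rescaled to
  total mass 1; it is meaningful where \<open>x v < 1\<close>.\<close>

definition away_from :: "'v \<Rightarrow> ('v \<Rightarrow> real) \<Rightarrow> 'v \<Rightarrow> real" where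
  "away_from v x = (\<lambda>w. if w = v then 0 else x w / (1 - x v))"

lemma sum_vertex_point: "finite V \<Longrightarrow> v \<in> V \<Longrightarrow> sum (vertex_point v) V = 1"
  by (simp add: vertex_point_def)

lemma sum_away_from:
  assumes "finite V" "v \<in> V" "sum x V = 1" "x v < 1"
  shows "sum (away_from v x) V = 1"
proof -
  have "sum (away_from v x) V = (\<Sum>w\<in>V - {v}. x w / (1 - x v))"
    using assms by (simp add: sum.remove[of V v] away_from_def)
  also have "\<dots> = (\<Sum>w\<in>V - {v}. x w) / (1 - x v)" by (simp add: sum_divide_distrib)
  also have "(\<Sum>w\<in>V - {v}. x w) = 1 - x v" using assms by (simp add: sum_diff1)
  finally show ?thesis using assms by simp
qed

lemma sum_segment:
  fixes x y :: "'v \<Rightarrow> real"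
  assumes "sum x V = 1" "sum y V = 1"
  shows "(\<Sum>w\<in>V. (1 - u) * x w + u * y w) = 1"
  using assms by (simp add: sum.distrib flip: sum_distrib_left)

text \<open>The segment from a point to the apex is supported on the support of the point together
  with \<open>v\<close>, which is again a face.\<close>

lemma fills_below_cone:
  assumes K: "complex_on V K" and v: "{v} \<in> K" and cone: "\<And>A. A \<in> K \<Longrightarrow> insert v A \<in> K"
  shows "fills_below D K"
  unfolding fills_below_def
proof (intro allI impI)
  fix p
  have V: "finite V" "v \<in> V" using K v by (auto simp: complex_on_def)
  have \<delta>: "vertex_point v \<in> realization K"
    using V by (intro in_realizationI[OF K _ v]) (auto simp: vertex_point_def)
  show "fillable p (realization K)"
  proof (rule fillable_segment_transfer[where r = "\<lambda>_. vertex_point v" and j = "\<lambda>x. x" and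
        S' = "{vertex_point v}", OF _ _ _ _ _ fillable_singleton])
    fix x :: "'a \<Rightarrow> real" and u :: real assume x: "x \<in> realization K" and u: "0 \<le> u" "u \<le> 1"
    have x': "\<And>w. 0 \<le> x w" "{w. x w \<noteq> 0} \<in> K" "sum x V = 1" using x realization_iff[OF K] by auto
    show "(\<lambda>w. (1 - u) * x w + u * vertex_point v w) \<in> realization K"
    proof (rule in_realizationI[OF K _ cone[OF x'(2)]])
      show "(\<Sum>w\<in>V. (1 - u) * x w + u * vertex_point v w) = 1"
        by (rule sum_segment[OF x'(3) sum_vertex_point[OF V]])
    qed (use x' u in \<open>auto simp: vertex_point_def\<close>)
  qed (use \<delta> in auto)
qed

lemma fills_below_vertex:
  assumes K: "complex_on V K" and v: "{v} \<in> K"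
    and del: "fills_below D (deletion v K)" and lnk: "fills_below (D - 1) (link v K)"
  shows "fills_below D K"
  unfolding fills_below_def
proof (intro allI impI)
  fix p assume p: "p < D"
  let ?U = "realization K"
  note KD = complex_on_deletion[OF K, of v] and KL = complex_on_link[OF K, of v]
  have V: "finite V" "v \<in> V" using K v by (auto simp: complex_on_def)
  have down: "\<And>A B. A \<in> K \<Longrightarrow> B \<subseteq> A \<Longrightarrow> B \<in> K" using K by (auto simp: complex_on_def)
  have U: "\<And>w. 0 \<le> x w" "{w. x w \<noteq> 0} \<in> K" "sum x V = 1" if "x \<in> ?U" for x
    using that realization_iff[OF K] by auto
  have away0: "away_from v x w = 0" if "x w = 0" for x w using that by (simp add: away_from_def)
  have away_nn: "0 \<le> away_from v x w" if "x \<in> ?U" "x v < 1" for x w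
    using U[OF that(1)] that(2) by (simp add: away_from_def)
  have away_v: "away_from v x v = 0" for x by (simp add: away_from_def)
  have away_cont: "continuous_on X (away_from v)" if "\<And>x. x \<in> X \<Longrightarrow> x v < 1" for X
    unfolding away_from_def
  proof (rule continuous_on_coordinatewise_then_product)
    fix w show "continuous_on X (\<lambda>x. if w = v then 0 else x w / (1 - x v))"
      using that by (cases "w = v") (force intro!: continuous_intros continuous_on_coord)+
  qed
  show "fillable p ?U"
  proof (rule fillable_union[where \<phi> = "\<lambda>x. x v"])
    show "continuous_on ?U (\<lambda>x. x v)" by (rule continuous_on_coord)
  next
    fix p' assume "p' \<le> p"
    then have "fillable p' (realization (deletion v K))" using del p by (simp add: fills_below_def)
    then show "fillable p' {x \<in> ?U. x v < 1}"
    proof (rule fillable_segment_transfer[where r = "away_from v" and j = "\<lambda>x. x", rotated -1])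
      show "continuous_on {x \<in> ?U. x v < 1} (away_from v)" by (rule away_cont) simp
      show "away_from v ` {x \<in> ?U. x v < 1} \<subseteq> realization (deletion v K)"
      proof clarify
        fix x assume x: "x \<in> ?U" "x v < 1"
        have "{w. x w \<noteq> 0} - {v} \<in> deletion v K"
          using down[OF U(2)[OF x(1)]] by (auto simp: deletion_def)
        then show "away_from v x \<in> realization (deletion v K)"
          using away_nn x U[OF x(1)] sum_away_from[OF V] away_v
          by (intro in_realizationI[OF KD]) (auto simp: away0)
      qed
      show "(\<lambda>x. x) ` realization (deletion v K) \<subseteq> {x \<in> ?U. x v < 1}"
        using realization_iff[OF KD] realization_iff[OF K] by (auto simp: deletion_def)
      fix x u assume x: "x \<in> {x \<in> ?U. x v < 1}" and u: "0 \<le> u" "u \<le> (1::real)"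
      then have xU: "x \<in> ?U" by simp
      have "(1 - u) * x v \<le> x v" using u U(1)[of x v] x by (simp add: mult_left_le_one_le)
      moreover have "(\<lambda>w. (1 - u) * x w + u * away_from v x w) \<in> ?U"
        using u away_nn[OF xU] x U(1)[OF xU]
          sum_segment[OF U(3)[OF xU] sum_away_from[OF V U(3)[OF xU]]]
        by (intro in_realizationI[OF K _ U(2)[OF xU]]) (auto simp: away0)
      ultimately show "(\<lambda>w. (1 - u) * x w + u * away_from v x w) \<in> {x \<in> ?U. x v < 1}"
        using x by (simp add: away_v)
    qed auto
  next
    fix p' assume "p' \<le> p"
    have \<delta>: "vertex_point v \<in> ?U"
      using V by (intro in_realizationI[OF K _ v]) (auto simp: vertex_point_def)
    show "fillable p' {x \<in> ?U. 0 < x v}"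
    proof (rule fillable_segment_transfer[where r = "\<lambda>_. vertex_point v" and j = "\<lambda>x. x" and
          S' = "{vertex_point v}", OF _ _ _ _ _ fillable_singleton])
      fix x u assume x: "x \<in> {x \<in> ?U. 0 < x v}" and u: "0 \<le> u" "u \<le> (1::real)"
      then have xU: "x \<in> ?U" by simp
      have "(\<lambda>w. (1 - u) * x w + u * vertex_point v w) \<in> ?U"
        using x u U(1)[OF xU] sum_segment[OF U(3)[OF xU] sum_vertex_point[OF V]]
        by (intro in_realizationI[OF K _ U(2)[OF xU]]) (auto simp: vertex_point_def)
      moreover have "0 < (1 - u) * x v + u"
        using x u by (cases "u = 0") (auto intro!: add_nonneg_pos)
      ultimately show "(\<lambda>w. (1 - u) * x w + u * vertex_point v w) \<in> {x \<in> ?U. 0 < x v}"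
        by (simp add: vertex_point_def)
    qed (use \<delta> in \<open>auto simp: vertex_point_def\<close>)
  next
    fix p' assume "p' < p"
    \<comment> \<open>From \<open>p' < p\<close> and \<open>p < D\<close> follows
      \<open>p' < D - 1\<close>: the dimension saved on the intersection is exactly the one missing
      for the link.\<close>
    then have "fillable p' (realization (link v K))" using lnk p by (simp add: fills_below_def)
    then show "fillable p' {x \<in> ?U. 0 < x v \<and> x v < 1}"
    \<comment> \<open>The link is placed in the intersection as the slice halfway between
      \<open>v\<close> and the opposite face, where the coordinate of \<open>v\<close> is
      1/2.\<close>
    proof (rule fillable_segment_transfer[where r = "away_from v" and
          j = "\<lambda>y w. (y w + vertex_point v w) / 2", rotated -1])
      show "continuous_on {x \<in> ?U. 0 < x v \<and> x v < 1} (away_from v)" by (rule away_cont) simp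
      show "away_from v ` {x \<in> ?U. 0 < x v \<and> x v < 1} \<subseteq> realization (link v K)"
      proof clarify
        fix x assume x: "x \<in> ?U" "0 < x v" "x v < 1"
        have "insert v ({w. x w \<noteq> 0} - {v}) = {w. x w \<noteq> 0}" using x(2) by auto
        then have "{w. x w \<noteq> 0} - {v} \<in> link v K"
          using U(2)[OF x(1)] by (simp add: link_def)
        then show "away_from v x \<in> realization (link v K)"
          using away_nn x U[OF x(1)] sum_away_from[OF V] away_v
          by (intro in_realizationI[OF KL]) (auto simp: away0)
      qed
      show "continuous_on (realization (link v K)) (\<lambda>y w. (y w + vertex_point v w) / 2)"
        by (intro continuous_on_coordinatewise_then_product continuous_intros continuous_on_coord) auto
      show "(\<lambda>y w. (y w + vertex_point v w) / 2) ` realization (link v K) \<subseteq> {x \<in> ?U. 0 < x v \<and> x v < 1}"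
      proof clarify
        fix y assume "y \<in> realization (link v K)"
        then have y: "\<And>w. 0 \<le> y w" "{w. y w \<noteq> 0} \<in> link v K" "sum y V = 1"
          using realization_iff[OF KL] by auto
        then have yv: "y v = 0" and ins: "insert v {w. y w \<noteq> 0} \<in> K" by (auto simp: link_def)
        have "(\<lambda>w. (y w + vertex_point v w) / 2) \<in> ?U"
          using y sum_vertex_point[OF V]
          by (intro in_realizationI[OF K _ ins])
            (auto simp: vertex_point_def sum.distrib simp flip: sum_divide_distrib)
        then show "(\<lambda>w. (y w + vertex_point v w) / 2) \<in> ?U \<and>
            0 < (y v + vertex_point v v) / 2 \<and> (y v + vertex_point v v) / 2 < 1"
          by (simp add: yv vertex_point_def)
      qed
      fix x u assume x: "x \<in> {x \<in> ?U. 0 < x v \<and> x v < 1}" and u: "0 \<le> u" "u \<le> (1::real)"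
      then have xU: "x \<in> ?U" by simp
      let ?j = "\<lambda>w. (away_from v x w + vertex_point v w) / 2"
      have "sum ?j V = 1"
        using sum_away_from[OF V, of x] sum_vertex_point[OF V] U(3)[of x] x
        by (simp add: sum.distrib flip: sum_divide_distrib)
      then have "(\<lambda>w. (1 - u) * x w + u * ?j w) \<in> ?U"
        using x u away_nn[OF xU] U(1)[OF xU] sum_segment[OF U(3)[OF xU], of ?j u]
        by (intro in_realizationI[OF K _ U(2)[OF xU]]) (auto simp: away0 vertex_point_def)
      moreover have "0 < (1 - u) * x v + u * (1/2)"
        using x u by (cases "u = 0") (auto intro!: add_nonneg_pos)
      moreover have "(1 - u) * x v + u * (1/2) < 1"
      proof (cases "u = 1")
        case False
        then have "(1 - u) * x v < (1 - u) * 1" using x u by (intro mult_strict_left_mono) auto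
        moreover have "a + u * (1/2) < 1" if "a < (1 - u) * 1" for a :: real using that u by simp
        ultimately show ?thesis by blast
      qed simp
      ultimately show "(\<lambda>w. (1 - u) * x w + u * ?j w) \<in> {x \<in> ?U. 0 < x v \<and> x v < 1}"
        by (simp add: away_v vertex_point_def)
    qed
  qed
qed

section \<open>Rook complexes on general boards\<close>

definition row_card :: "('c \<times> 'r) set \<Rightarrow> 'r \<Rightarrow> nat" where
  "row_card A r = card {x \<in> A. snd x = r}"

definition rook_complex :: "('c \<times> 'r) set \<Rightarrow> 'r set \<Rightarrow> ('r \<Rightarrow> nat) \<Rightarrow> nat \<Rightarrow> ('c \<times> 'r) set set" where
  "rook_complex V R a s =
     {A. A \<subseteq> V \<and> inj_on fst A \<and> (\<forall>r\<in>R. row_card A r \<le> Suc (a r)) \<and>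
         card {r\<in>R. a r < row_card A r} \<le> s}"

lemma row_card_mono: "finite B \<Longrightarrow> A \<subseteq> B \<Longrightarrow> row_card A r \<le> row_card B r"
  unfolding row_card_def by (intro card_mono) auto

lemma row_card_insert:
  assumes "finite A" "(c, r) \<notin> A"
  shows "row_card (insert (c, r) A) r' = (if r' = r then Suc (row_card A r') else row_card A r')"
proof -
  have "{x \<in> insert (c, r) A. snd x = r'} =
      (if r' = r then insert (c, r) {x \<in> A. snd x = r'} else {x \<in> A. snd x = r'})" by auto
  then show ?thesis using assms by (simp add: row_card_def)
qed

lemma row_card_eq_0_iff: "finite A \<Longrightarrow> row_card A r = 0 \<longleftrightarrow> (\<forall>x\<in>A. snd x \<noteq> r)"
proof -
  assume "finite A"
  then have "row_card A r = 0 \<longleftrightarrow> {x \<in> A. snd x = r} = {}" unfolding row_card_def by simp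
  then show ?thesis by blast
qed

text \<open>A row has at most one square in column \<open>c\<close>. The hypothesis looks at row
  \<open>r\<close> alone, so squares of other rows may be removed at the same time.\<close>

lemma row_card_lose_column:
  assumes "finite V'" and "\<And>x. x \<in> V \<Longrightarrow> snd x = r \<Longrightarrow> fst x \<noteq> c \<Longrightarrow> x \<in> V'"
  shows "row_card V r \<le> Suc (row_card V' r)"
proof -
  have "{x \<in> V. snd x = r} \<subseteq> insert (c, r) {x \<in> V'. snd x = r}" using assms(2) by force
  then have "row_card V r \<le> card (insert (c, r) {x \<in> V'. snd x = r})"
    unfolding row_card_def using assms(1) by (intro card_mono) auto
  also have "\<dots> \<le> Suc (row_card V' r)"
    unfolding row_card_def using assms(1) by (simp add: card_insert_if)
  finally show ?thesis .
qed

lemma rook_complex_downward: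
  assumes "finite V" "finite R" "A \<in> rook_complex V R a s" "B \<subseteq> A"
  shows "B \<in> rook_complex V R a s"
proof -
  have A: "A \<subseteq> V" "inj_on fst A" "\<And>r. r \<in> R \<Longrightarrow> row_card A r \<le> Suc (a r)"
    "card {r\<in>R. a r < row_card A r} \<le> s"
    using assms(3) by (auto simp: rook_complex_def)
  have le: "row_card B r \<le> row_card A r" for r
    using A(1) assms by (intro row_card_mono) (auto intro: finite_subset)
  have "card {r\<in>R. a r < row_card B r} \<le> card {r\<in>R. a r < row_card A r}"
    using assms(2) le by (intro card_mono) (auto intro: less_le_trans)
  then show ?thesis
    using A assms(4) order_trans[OF le] unfolding rook_complex_def
    by (auto intro: inj_on_subset)
qed

lemma complex_on_rook_complex: "finite V \<Longrightarrow> finite R \<Longrightarrow> complex_on V (rook_complex V R a s)"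
  unfolding complex_on_def
  by (intro conjI ballI allI impI) (assumption, force simp: rook_complex_def, rule rook_complex_downward)

lemma empty_in_rook_complex: "{} \<in> rook_complex V R a s"
  by (simp add: rook_complex_def row_card_def)

lemma deletion_rook_complex: "deletion v (rook_complex V R a s) = rook_complex (V - {v}) R a s"
  by (auto simp: deletion_def rook_complex_def)

text \<open>Iterates the vertex step: \<open>W'\<close> is the part of \<open>W\<close> already
  removed when \<open>v\<close> is treated, so links are needed in all intermediate boards. A square
  that is not a vertex costs nothing, as deleting it leaves the complex unchanged.\<close>

lemma fills_below_delete_set:
  assumes "finite W" and V: "finite V" "finite R"
    and lnk: "\<And>W' v. W' \<subseteq> W \<Longrightarrow> v \<in> W - W' \<Longrightarrow> {v} \<in> rook_complex (V - W') R a s \<Longrightarrow>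
       fills_below (D - 1) (link v (rook_complex (V - W') R a s))"
    and fin: "fills_below D (rook_complex (V - W) R a s)"
  shows "fills_below D (rook_complex V R a s)"
  using assms
proof (induction W arbitrary: V rule: finite_induct)
  case (insert v W)
  note K = complex_on_rook_complex[OF insert.prems(1,2), of a s]
  have step: "fills_below D (rook_complex (V - {v}) R a s)"
  proof (rule insert.IH)
    fix W' u assume W': "W' \<subseteq> W" "u \<in> W - W'" "{u} \<in> rook_complex (V - {v} - W') R a s"
    have "V - {v} - W' = V - insert v W'" by auto
    then show "fills_below (D - 1) (link u (rook_complex (V - {v} - W') R a s))"
      using insert.prems(3)[of "insert v W'" u] W' insert.hyps(2) by auto
  next
    have "V - {v} - W = V - insert v W" by auto
    then show "fills_below D (rook_complex (V - {v} - W) R a s)" using insert.prems(4) by simp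
  qed (use insert.prems in auto)
  show ?case
  proof (cases "{v} \<in> rook_complex V R a s")
    case True
    with insert.prems(3)[of "{}" v] insert.hyps(2) step show ?thesis
      by (intro fills_below_vertex[OF K]) (auto simp: deletion_rook_complex)
  next
    case False
    then have "deletion v (rook_complex V R a s) = rook_complex V R a s"
      using K by (auto simp: deletion_def complex_on_def)
    then show ?thesis using step by (simp add: deletion_rook_complex)
  qed
qed simp

text \<open>The rook at \<open>(c, r)\<close> raises the count of row \<open>r\<close> by one;
  lowering the capacity by one compensates this in the row bound and in the test for excess, so the
  budget is untouched.\<close>

lemma link_rook_complex_Suc:
  assumes fin: "finite V" and v: "(c, r) \<in> V" "r \<in> R" and a: "a r = Suc b"
  shows "link (c, r) (rook_complex V R a s) = rook_complex {x \<in> V. fst x \<noteq> c} R (a(r := b)) s"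
proof (rule set_eqI)
  fix A
  show "A \<in> link (c, r) (rook_complex V R a s) \<longleftrightarrow>
        A \<in> rook_complex {x \<in> V. fst x \<noteq> c} R (a(r := b)) s"
  proof (cases "A \<subseteq> V \<and> (c, r) \<notin> A")
    case True
    then have A: "finite A" "A \<subseteq> V" "(c, r) \<notin> A" using fin finite_subset by auto
    have 1: "inj_on fst (insert (c, r) A) \<longleftrightarrow> inj_on fst A \<and> A \<subseteq> {x \<in> V. fst x \<noteq> c}"
      using A by (force simp: inj_on_insert)
    have 2: "row_card (insert (c, r) A) r' \<le> Suc (a r') \<longleftrightarrow> row_card A r' \<le> Suc ((a(r := b)) r')"
      and 3: "a r' < row_card (insert (c, r) A) r' \<longleftrightarrow> (a(r := b)) r' < row_card A r'" for r'
      using row_card_insert[OF A(1,3), of r'] a by auto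
    show ?thesis
      unfolding link_def rook_complex_def mem_Collect_eq 1 2 3 using A v by auto
  qed (auto simp: link_def rook_complex_def)
qed

text \<open>With capacity 0 the rook is itself the excess rook: row \<open>r\<close> is full, takes
  no further rook, and has spent one unit of the budget. It therefore leaves the board.\<close>

lemma link_rook_complex_0:
  assumes fin: "finite V" "finite R" and v: "(c, r) \<in> V" "r \<in> R" and a: "a r = 0"
  shows "link (c, r) (rook_complex V R a (Suc s)) =
         rook_complex {x \<in> V. fst x \<noteq> c \<and> snd x \<noteq> r} (R - {r}) a s"
proof (rule set_eqI)
  fix A
  show "A \<in> link (c, r) (rook_complex V R a (Suc s)) \<longleftrightarrow>
        A \<in> rook_complex {x \<in> V. fst x \<noteq> c \<and> snd x \<noteq> r} (R - {r}) a s"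
  proof (cases "A \<subseteq> V \<and> (c, r) \<notin> A")
    case True
    then have A: "finite A" "A \<subseteq> V" "(c, r) \<notin> A" using fin finite_subset by auto
    note rc = row_card_insert[OF A(1,3)]
    have 1: "inj_on fst (insert (c, r) A) \<longleftrightarrow> inj_on fst A \<and> A \<subseteq> {x \<in> V. fst x \<noteq> c}"
      using A by (force simp: inj_on_insert)
    have 2: "(\<forall>r'\<in>R. row_card (insert (c, r) A) r' \<le> Suc (a r')) \<longleftrightarrow>
        (\<forall>r'\<in>R - {r}. row_card A r' \<le> Suc (a r')) \<and> (\<forall>x\<in>A. snd x \<noteq> r)"
      using v a row_card_eq_0_iff[OF A(1), of r] by (auto simp: rc)
    have "{r'\<in>R. a r' < row_card (insert (c, r) A) r'} = insert r {r'\<in>R - {r}. a r' < row_card A r'}"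
      using v a by (auto simp: rc)
    then have 3: "card {r'\<in>R. a r' < row_card (insert (c, r) A) r'} =
        Suc (card {r'\<in>R - {r}. a r' < row_card A r'})"
      using fin by simp
    show ?thesis
      unfolding link_def rook_complex_def mem_Collect_eq 1 2 3 using A v by auto
  qed (auto simp: link_def rook_complex_def)
qed

text \<open>A vertex in a row of capacity 0 forces a positive budget, which is the form of
  \<open>s\<close> that the link formula for such rows requires.\<close>

lemma exhausted_row_vertex:
  assumes "finite R" "r \<in> R" "a r = 0"
  shows "{(c, r)} \<notin> rook_complex V R a 0"
proof
  assume "{(c, r)} \<in> rook_complex V R a 0"
  then have "{r' \<in> R. a r' < row_card {(c, r)} r'} = {}"
    using assms(1) by (simp add: rook_complex_def)
  moreover have "row_card {(c, r)} r = 1"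
    using row_card_insert[of "{}" c r r] by (simp add: row_card_def)
  ultimately show False using assms by auto
qed

text \<open>Removing an empty row from \<open>R\<close> keeps the complex but lowers
  \<open>card R\<close>, which relaxes the bound on all other rows by one square.\<close>

lemma empty_row:
  assumes "finite V" "r \<in> R" "\<forall>x\<in>V. snd x \<noteq> r"
  shows "rook_complex V R a s = rook_complex V (R - {r}) a s"
proof -
  have z: "row_card A r = 0" if "A \<subseteq> V" for A
    using that assms by (subst row_card_eq_0_iff) (auto intro: finite_subset)
  have "{r' \<in> R. a r' < row_card A r'} = {r' \<in> R - {r}. a r' < row_card A r'}" if "A \<subseteq> V" for A
    using z[OF that] by auto
  moreover have "(\<forall>r'\<in>R. row_card A r' \<le> Suc (a r')) \<longleftrightarrow> (\<forall>r'\<in>R - {r}. row_card A r' \<le> Suc (a r'))"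
    if "A \<subseteq> V" for A
    using z[OF that] by auto
  ultimately show ?thesis unfolding rook_complex_def by (intro Collect_cong) (metis (no_types, lifting))
qed

text \<open>The square is a cone point: it conflicts with no rook in its column or row. Adding it
  either leaves the row within its capacity, or may create an excess row, which is harmless when the
  budget allows every row to be one.\<close>

lemma fills_below_lone_square:
  assumes fin: "finite V" "finite R" and c: "(c, r) \<in> V" "r \<in> R"
    and col: "\<forall>x\<in>V. fst x = c \<longrightarrow> x = (c, r)" and row: "\<forall>x\<in>V. snd x = r \<longrightarrow> x = (c, r)"
    and room: "0 < a r \<or> s = card R"
  shows "fills_below D (rook_complex V R a s)"
proof -
  have cone: "insert (c, r) A \<in> rook_complex V R a s" if A: "A \<in> rook_complex V R a s" for A
  proof (cases "(c, r) \<in> A")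
    case False
    have AV: "A \<subseteq> V" "finite A" using A fin finite_subset by (auto simp: rook_complex_def)
    have inj: "inj_on fst (insert (c, r) A)"
      using A AV col False by (force simp: rook_complex_def inj_on_insert)
    have r0: "row_card A r = 0" using row_card_eq_0_iff[OF AV(2)] AV row False by auto
    have rows: "row_card (insert (c, r) A) r' \<le> Suc (a r')" if "r' \<in> R" for r'
      using A that r0 row_card_insert[OF AV(2) False] by (auto simp: rook_complex_def)
    have "card {r' \<in> R. a r' < row_card (insert (c, r) A) r'} \<le> s"
    proof (cases "0 < a r")
      case True
      then have "{r' \<in> R. a r' < row_card (insert (c, r) A) r'} = {r' \<in> R. a r' < row_card A r'}"
        using r0 row_card_insert[OF AV(2) False] by auto
      then show ?thesis using A by (simp add: rook_complex_def)
    next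
      case False
      then show ?thesis using room fin by (auto intro: card_mono)
    qed
    then show ?thesis using AV c inj rows by (auto simp: rook_complex_def)
  qed (use A in \<open>simp add: insert_absorb\<close>)
  show ?thesis
    by (rule fills_below_cone[OF complex_on_rook_complex[OF fin] cone[OF empty_in_rook_complex] cone])
qed

text \<open>For the full board with all capacities \<open>\<nu>\<close> the last condition reads
  \<open>n * \<nu> + n + s \<le> m + 1\<close>, the hypothesis on m. A link lowers the left side by
  one (a capacity drops) or by two (a row and a unit of budget disappear), while each surviving row
  loses at most one square.\<close>

definition rich :: "('c \<times> 'r) set \<Rightarrow> 'r set \<Rightarrow> ('r \<Rightarrow> nat) \<Rightarrow> nat \<Rightarrow> bool" where
  "rich V R a s \<longleftrightarrow> finite V \<and> finite R \<and> snd ` V \<subseteq> R \<and> s \<le> card R \<and>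
     (\<forall>r\<in>R. sum a R + card R + s \<le> row_card V r + 1)"

text \<open>Since column c is reserved for row r0, every other row may have one square less.\<close>

definition rich_but_one ::
    "('c \<times> 'r) set \<Rightarrow> 'r set \<Rightarrow> ('r \<Rightarrow> nat) \<Rightarrow> nat \<Rightarrow> 'c \<Rightarrow> 'r \<Rightarrow> bool" where
  "rich_but_one V R a s c r0 \<longleftrightarrow> finite V \<and> finite R \<and> snd ` V \<subseteq> R \<and> s \<le> card R \<and>
     r0 \<in> R \<and> (c, r0) \<in> V \<and> (\<forall>x\<in>V. fst x = c \<longrightarrow> x = (c, r0)) \<and>
     (\<forall>r\<in>R - {r0}. sum a R + card R + s \<le> row_card V r + 2)"

section \<open>The joint induction over boards\<close>

lemma sum_update_Suc:
  fixes a :: "'r \<Rightarrow> nat"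
  assumes "finite R" "r \<in> R" "a r = Suc b"
  shows "sum a R = Suc (sum (a(r := b)) R)"
proof -
  have "sum (a(r := b)) (R - {r}) = sum a (R - {r})" by (intro sum.cong) auto
  then show ?thesis using assms by (simp add: sum.remove[of R r])
qed

lemma sum_remove_0:
  fixes a :: "'r \<Rightarrow> nat"
  shows "finite R \<Longrightarrow> r \<in> R \<Longrightarrow> a r = 0 \<Longrightarrow> sum a (R - {r}) = sum a R"
  by (simp add: sum.remove[of R r])

text \<open>All deletions happen in row \<open>r0\<close>, whose length the invariant ignores, so
  another row loses only its square in the column of the link. If \<open>a0 r0\<close> is 0, both
  \<open>card R0\<close> and \<open>s0\<close> drop, one square is gained and the link is
  \<open>rich\<close>; otherwise only the capacity sum drops and the link is
  \<open>rich_but_one\<close> again.\<close>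

lemma rich_but_one_step:
  fixes V0 :: "('c \<times> 'r) set"
  assumes IH: "\<And>(V :: ('c \<times> 'r) set) R a s. sum a R + card R < sum a0 R0 + card R0 \<Longrightarrow> rich V R a s \<Longrightarrow>
        fills_below (sum a R + s) (rook_complex V R a s)"
    and IH1: "\<And>(V :: ('c \<times> 'r) set) R a s c r. sum a R + card R < sum a0 R0 + card R0 \<Longrightarrow> rich_but_one V R a s c r \<Longrightarrow>
        fills_below (sum a R + s) (rook_complex V R a s)"
    and R: "rich_but_one V0 R0 a0 s0 c0 r0"
  shows "fills_below (sum a0 R0 + s0) (rook_complex V0 R0 a0 s0)"
proof -
  have fin: "finite V0" "finite R0" and s: "s0 \<le> card R0" "snd ` V0 \<subseteq> R0"and r0: "r0 \<in> R0" "(c0, r0) \<in> V0"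
    and col: "\<forall>x\<in>V0. fst x = c0 \<longrightarrow> x = (c0, r0)"
    and big: "\<And>r. r \<in> R0 - {r0} \<Longrightarrow> sum a0 R0 + card R0 + s0 \<le> row_card V0 r + 2"
    using R by (auto simp: rich_but_one_def)
  have cR: "card R0 = Suc (card (R0 - {r0}))" using card.remove[OF fin(2) r0(1)] .
  \<comment> \<open>If \<open>a0 r0\<close> is 0 and the budget does not cover all rows, the
    reserved square is no cone point, as adding it could exceed the budget. It is then deleted too,
    and \<open>s0 < card R0\<close> keeps the budget admissible once the row is gone.\<close>
  define W where "W = (if a0 r0 = 0 \<and> s0 < card R0 then {x \<in> V0. snd x = r0}
      else {x \<in> V0. snd x = r0 \<and> fst x \<noteq> c0})"
  have W: "W \<subseteq> {x \<in> V0. snd x = r0}" by (auto simp: W_def)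
  show ?thesis
  proof (rule fills_below_delete_set[OF _ fin, of W])
    show "finite W" using W fin(1) by (auto intro: finite_subset[of W V0])
  next
    fix W' v assume W': "W' \<subseteq> W" "v \<in> W - W'" and vK: "{v} \<in> rook_complex (V0 - W') R0 a0 s0"
    obtain c where v: "v = (c, r0)" using W' W by (cases v) auto
    have vV: "(c, r0) \<in> V0 - W'" using W' W v by auto
    have finV: "finite (V0 - W')" using fin by simp
    show "fills_below (sum a0 R0 + s0 - 1) (link v (rook_complex (V0 - W') R0 a0 s0))"
    proof (cases "a0 r0")
      case 0
      then obtain s' where s': "s0 = Suc s'"
        using exhausted_row_vertex[OF fin(2) r0(1), of a0 c "V0 - W'"] 0 vK v by (cases s0) auto
      let ?V = "{x \<in> V0 - W'. fst x \<noteq> c \<and> snd x \<noteq> r0}"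
      have e: "sum a0 (R0 - {r0}) = sum a0 R0" by (rule sum_remove_0[where a = a0, OF fin(2) r0(1) 0])
      have "sum a0 R0 + card (R0 - {r0}) + s' \<le> row_card ?V r + 1" if r: "r \<in> R0 - {r0}" for r
      proof -
        have "row_card V0 r \<le> Suc (row_card ?V r)"
          using r W W' fin by (intro row_card_lose_column[where c = c]) auto
        then show ?thesis using big[OF r] s' cR by linarith
      qed
      then have "rich ?V (R0 - {r0}) a0 s'"
        using fin s s' cR unfolding rich_def e by auto
      then have "fills_below (sum a0 (R0 - {r0}) + s') (rook_complex ?V (R0 - {r0}) a0 s')"
        using cR e by (intro IH) auto
      then show ?thesis
        unfolding v s' e link_rook_complex_0[where r = r0 and R = R0 and a = a0, OF finV fin(2) vV r0(1) 0]
        by simp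
    next
      case (Suc b)
      \<comment> \<open>With positive capacity \<open>W\<close> spares the reserved square, so it
        survives into the link.\<close>
      have c: "c \<noteq> c0" using W' v Suc by (auto simp: W_def)
      let ?V = "{x \<in> V0 - W'. fst x \<noteq> c}" and ?a = "a0(r0 := b)"
      have e: "sum a0 R0 = Suc (sum ?a R0)" by (rule sum_update_Suc[where a = a0, OF fin(2) r0(1) Suc])
      have "sum ?a R0 + card R0 + s0 \<le> row_card ?V r + 2" if r: "r \<in> R0 - {r0}" for r
      proof -
        have "row_card V0 r \<le> Suc (row_card ?V r)"
          using r W W' fin by (intro row_card_lose_column[where c = c]) auto
        then show ?thesis using big[OF r] e by linarith
      qed
      moreover have "(c0, r0) \<in> ?V" using r0 c W' Suc by (auto simp: W_def)
      moreover have "finite ?V" "snd ` ?V \<subseteq> R0" "\<forall>x\<in>?V. fst x = c0 \<longrightarrow> x = (c0, r0)"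
        using fin s(2) col by auto
      ultimately have "rich_but_one ?V R0 ?a s0 c0 r0"
        unfolding rich_but_one_def using fin(2) s(1) r0(1) by simp
      then have "fills_below (sum ?a R0 + s0) (rook_complex ?V R0 ?a s0)"
        using e by (intro IH1) auto
      then show ?thesis
        unfolding v e link_rook_complex_Suc[where r = r0 and R = R0 and a = a0, OF finV vV r0(1) Suc]
        by simp
    qed
  next
    show "fills_below (sum a0 R0 + s0) (rook_complex (V0 - W) R0 a0 s0)"
    proof (cases "a0 r0 = 0 \<and> s0 < card R0")
      case True
      let ?V = "V0 - W"
      have e: "sum a0 (R0 - {r0}) = sum a0 R0" by (rule sum_remove_0[OF fin(2) r0(1)]) (use True in simp)
      \<comment> \<open>The other rows keep their length while the number of rows drops by one; this
        restores the bound from slack 2 to slack 1.\<close>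
      have "sum a0 R0 + card (R0 - {r0}) + s0 \<le> row_card ?V r + 1" if r: "r \<in> R0 - {r0}" for r
      proof -
        have "{x \<in> V0. snd x = r} = {x \<in> V0 - W. snd x = r}" using W r by auto
        then have "row_card V0 r = row_card ?V r" by (simp add: row_card_def)
        then show ?thesis using big[OF r] cR by linarith
      qed
      moreover have "snd ` ?V \<subseteq> R0 - {r0}" using s(2) True by (auto simp: W_def)
      ultimately have "rich ?V (R0 - {r0}) a0 s0"
        using fin cR True unfolding rich_def e by auto
      then have "fills_below (sum a0 (R0 - {r0}) + s0) (rook_complex ?V (R0 - {r0}) a0 s0)"
        using cR e by (intro IH) auto
      moreover have "rook_complex ?V R0 a0 s0 = rook_complex ?V (R0 - {r0}) a0 s0"
        using fin True by (intro empty_row r0) (auto simp: W_def)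
      ultimately show ?thesis using e by simp
    next
      case False
      then have We: "W = {x \<in> V0. snd x = r0 \<and> fst x \<noteq> c0}" by (auto simp: W_def)
      show ?thesis
      proof (rule fills_below_lone_square[OF _ fin(2) _ r0(1)])
        show "finite (V0 - W)" using fin by simp
        show "(c0, r0) \<in> V0 - W" using r0 We by simp
        show "\<forall>x\<in>V0 - W. fst x = c0 \<longrightarrow> x = (c0, r0)" using col by blast
        show "\<forall>x\<in>V0 - W. snd x = r0 \<longrightarrow> x = (c0, r0)" using col We by blast
        show "0 < a0 r0 \<or> s0 = card R0" using False s(1) by linarith
      qed
    qed
  qed
qed

text \<open>All deletions happen in column \<open>c0\<close>, which the link removes anyway, so
  earlier deletions cost it nothing further and the link is \<open>rich\<close>. Once the column is
  cleared except for \<open>(c0, r0)\<close>, the dimension is unchanged and each other row is short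
  by at most one square, which is \<open>rich_but_one\<close>.\<close>

lemma rich_step:
  fixes V0 :: "('c \<times> 'r) set"
  assumes IH: "\<And>(V :: ('c \<times> 'r) set) R a s. sum a R + card R < sum a0 R0 + card R0 \<Longrightarrow> rich V R a s \<Longrightarrow>
        fills_below (sum a R + s) (rook_complex V R a s)"
    and one: "\<And>(V :: ('c \<times> 'r) set) s c r. rich_but_one V R0 a0 s c r \<Longrightarrow>
        fills_below (sum a0 R0 + s) (rook_complex V R0 a0 s)"
    and R: "rich V0 R0 a0 s0"
  shows "fills_below (sum a0 R0 + s0) (rook_complex V0 R0 a0 s0)"
proof (cases "sum a0 R0 + s0 = 0")
  case True
  then show ?thesis by (simp add: fills_below_def)
next
  case False
  have fin: "finite V0" "finite R0" and s: "s0 \<le> card R0" "snd ` V0 \<subseteq> R0"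
    and big: "\<And>r. r \<in> R0 \<Longrightarrow> sum a0 R0 + card R0 + s0 \<le> row_card V0 r + 1"
    using R by (auto simp: rich_def)
  have "R0 \<noteq> {}" using False s by auto
  then obtain r0 where r0: "r0 \<in> R0" by blast
  have "card R0 > 0" using \<open>R0 \<noteq> {}\<close> fin by (simp add: card_gt_0_iff)
  \<comment> \<open>The left side of the bound is at least 2 here, one from the row itself and one
    from the nonzero dimension, so the row has a square to reserve.\<close>
  then have "row_card V0 r0 \<noteq> 0" using big[OF r0] False by linarith
  then obtain c0 where c0: "(c0, r0) \<in> V0" using row_card_eq_0_iff[OF fin(1), of r0] by (metis prod.collapse)
  define W where "W = {x \<in> V0. fst x = c0 \<and> snd x \<noteq> r0}"
  show ?thesis
  proof (rule fills_below_delete_set[OF _ fin, of W])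
    show "finite W" using fin by (simp add: W_def)
  next
    fix W' v assume W': "W' \<subseteq> W" "v \<in> W - W'" and vK: "{v} \<in> rook_complex (V0 - W') R0 a0 s0"
    obtain r where v: "v = (c0, r)" using W' by (cases v) (auto simp: W_def)
    have vV: "(c0, r) \<in> V0 - W'" using W' v by (auto simp: W_def)
    have finV: "finite (V0 - W')" using fin by simp
    show "fills_below (sum a0 R0 + s0 - 1) (link v (rook_complex (V0 - W') R0 a0 s0))"
    proof -
      have rR: "r \<in> R0" using vV s(2) by force
      have cR: "card R0 = Suc (card (R0 - {r}))" using card.remove[OF fin(2) rR] .
      show ?thesis
      proof (cases "a0 r")
        case 0
        then obtain s' where s': "s0 = Suc s'"
          using exhausted_row_vertex[OF fin(2) rR, of a0 c0 "V0 - W'"] 0 vK v by (cases s0) auto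
        let ?V = "{x \<in> V0 - W'. fst x \<noteq> c0 \<and> snd x \<noteq> r}"
        have e: "sum a0 (R0 - {r}) = sum a0 R0" by (rule sum_remove_0[where a = a0, OF fin(2) rR 0])
        have "sum a0 R0 + card (R0 - {r}) + s' \<le> row_card ?V r' + 1" if r': "r' \<in> R0 - {r}" for r'
        proof -
          have "row_card V0 r' \<le> Suc (row_card ?V r')"
            using r' W' fin by (intro row_card_lose_column[where c = c0]) (auto simp: W_def)
          then show ?thesis using big[of r'] r' s' cR by auto
        qed
        then have "rich ?V (R0 - {r}) a0 s'"
          using fin s s' cR unfolding rich_def e by auto
        then have "fills_below (sum a0 (R0 - {r}) + s') (rook_complex ?V (R0 - {r}) a0 s')"
          using cR e by (intro IH) auto
        then show ?thesis
          unfolding v s' e link_rook_complex_0[where r = r and R = R0 and a = a0, OF finV fin(2) vV rR 0]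
          by simp
      next
        case (Suc b)
        let ?V = "{x \<in> V0 - W'. fst x \<noteq> c0}" and ?a = "a0(r := b)"
        have e: "sum a0 R0 = Suc (sum ?a R0)" by (rule sum_update_Suc[where a = a0, OF fin(2) rR Suc])
        have "sum ?a R0 + card R0 + s0 \<le> row_card ?V r' + 1" if r': "r' \<in> R0" for r'
        proof -
          have "row_card V0 r' \<le> Suc (row_card ?V r')"
            using W' fin by (intro row_card_lose_column[where c = c0]) (auto simp: W_def)
          then show ?thesis using big[OF r'] e by linarith
        qed
        then have "rich ?V R0 ?a s0"
          using fin s unfolding rich_def by auto
        then have "fills_below (sum ?a R0 + s0) (rook_complex ?V R0 ?a s0)"
          using e by (intro IH) auto
        then show ?thesis
          unfolding v e link_rook_complex_Suc[where r = r and R = R0 and a = a0, OF finV vV rR Suc]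
          by simp
      qed
    qed
  next
    have "sum a0 R0 + card R0 + s0 \<le> row_card (V0 - W) r + 2" if r: "r \<in> R0" for r
    proof -
      have "row_card V0 r \<le> Suc (row_card (V0 - W) r)"
        using fin by (intro row_card_lose_column[where c = c0]) (auto simp: W_def)
      then show ?thesis using big[OF r] by linarith
    qed
    then have "rich_but_one (V0 - W) R0 a0 s0 c0 r0"
      using fin s c0 r0 unfolding rich_but_one_def by (auto simp: W_def)
    then show "fills_below (sum a0 R0 + s0) (rook_complex (V0 - W) R0 a0 s0)" by (rule one)
  qed
qed

text \<open>Clearing a column changes neither the capacities nor the rows, so a \<open>rich\<close>
  board leads to a \<open>rich_but_one\<close> board of the same measure. Within one value of
  \<open>n\<close> the latter case therefore comes first.\<close>

lemma rich_fills:
  "(\<forall>(V :: ('c \<times> 'r) set) R a s. sum a R + card R = n \<longrightarrow> rich V R a s \<longrightarrow> fills_below (sum a R + s) (rook_complex V R a s)) \<and>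
   (\<forall>(V :: ('c \<times> 'r) set) R a s c r. sum a R + card R = n \<longrightarrow> rich_but_one V R a s c r \<longrightarrow>
      fills_below (sum a R + s) (rook_complex V R a s))"
proof (induction n rule: less_induct)
  case (less n)
  have one: "fills_below (sum a R + s) (rook_complex V R a s)"
    if n: "sum a R + card R = n" and "rich_but_one V R a s c r" for V :: "('c \<times> 'r) set" and R a s c r
    by (rule rich_but_one_step[OF _ _ that(2)]) (use less.IH n in blast)+
  have "fills_below (sum a R + s) (rook_complex V R a s)"
    if n: "sum a R + card R = n" and "rich V R a s" for V :: "('c \<times> 'r) set" and R a s
    by (rule rich_step[OF _ _ that(2)]) (use less.IH n one in blast)+
  with one show ?case by blast
qed

section \<open>Homotopy groups of the chessboard complexes\<close>

lemma quotient_all_related: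
  assumes "equiv A r" "a \<in> A" "\<And>x y. x \<in> A \<Longrightarrow> y \<in> A \<Longrightarrow> (x, y) \<in> r"
  shows "is_singleton (A // r)"
proof (rule is_singletonI')
  show "A // r \<noteq> {}" using assms(2) by (auto simp: quotient_def)
  fix X Y assume "X \<in> A // r" "Y \<in> A // r"
  then obtain x y where "x \<in> A" "y \<in> A" "X = r `` {x}" "Y = r `` {y}" by (auto elim!: quotientE)
  then show "X = Y" using equiv_class_eq[OF assms(1)] assms(3) by metis
qed

lemma topspace_unit_cube: "topspace (unit_cube i) = (\<Pi>\<^sub>E j\<in>{..<i}. {0..1})"
  by (simp add: unit_cube_def)

text \<open>Two based maps agree with the base point on the side faces, so on the boundary of the
  (i+1)-cube they can be pasted at height 1/2; a filling is a homotopy between them.\<close>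

lemma fillable_imp_homotopy_group_trivial:
  fixes S :: "'a::topological_space set"
  assumes S: "fillable (Suc i) S" and x0: "x0 \<in> S"
  shows "is_singleton (homotopy_group i (top_of_set S) x0)"
  unfolding homotopy_group_def
proof (rule quotient_all_related[OF equiv_based_homotopy_rel])
  show "(\<lambda>_. x0) \<in> based_cube_maps i (top_of_set S) x0"
    using x0 by (simp add: based_cube_maps_def)
  fix f g assume "f \<in> based_cube_maps i (top_of_set S) x0" "g \<in> based_cube_maps i (top_of_set S) x0"
  then have f: "continuous_map (unit_cube i) (top_of_set S) f" "\<And>t. t \<in> cube_boundary i \<Longrightarrow> f t = x0"
    and g: "continuous_map (unit_cube i) (top_of_set S) g" "\<And>t. t \<in> cube_boundary i \<Longrightarrow> g t = x0"
    by (auto simp: based_cube_maps_def)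
  \<comment> \<open>The unit cube in coordinates 0 to i, with all later coordinates fixed at 0;
    coordinate i is the time of the homotopy.\<close>
  define lo hi :: "nat \<Rightarrow> real" where "lo = (\<lambda>_. 0)" and "hi = (\<lambda>j. if j \<le> i then 1 else 0)"
  \<comment> \<open>Points of \<open>unit_cube i\<close> are extensional functions, so the later
    coordinates must be reset to \<open>undefined\<close>.\<close>
  define base :: "(nat \<Rightarrow> real) \<Rightarrow> nat \<Rightarrow> real" where "base t = restrict t {..<i}" for t
  define \<Phi> where "\<Phi> t = (if t i \<le> 1/2 then f (base t) else g (base t))" for t
  have d: "dirs lo hi = {..i}" by (auto simp: dirs_def lo_def hi_def)
  have c: "is_cell (Suc i) lo hi"
    unfolding is_cell_def d by (auto simp: lo_def hi_def)
  have cell_bounds: "0 \<le> t j \<and> t j \<le> 1" if "t \<in> cell lo hi" "j \<le> i" for t j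
    using that by (auto simp: cell_def lo_def hi_def dest!: spec[of _ j])
  have base_cont: "continuous_map (top_of_set (cell lo hi)) (unit_cube i) base"
    unfolding unit_cube_def continuous_map_componentwise
  proof (intro conjI ballI)
    fix j assume j: "j \<in> {..<i}"
    have "continuous_on (cell lo hi) (\<lambda>t. base t j)"
      using j continuous_on_coord[of "cell lo hi" j] by (simp add: base_def)
    then show "continuous_map (top_of_set (cell lo hi)) (top_of_set {0..1}) (\<lambda>t. base t j)"
      using j cell_bounds[of _ j] by (auto simp: continuous_map_in_subtopology base_def image_subset_iff)
  qed (auto simp: base_def)
  have lift_cont: "continuous_on (cell lo hi) (\<lambda>t. h (base t))" and lift_S: "\<And>t. t \<in> cell lo hi \<Longrightarrow> h (base t) \<in> S"
    if "continuous_map (unit_cube i) (top_of_set S) h" for h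
    using continuous_map_compose[OF base_cont that]
    by (auto simp: continuous_map_in_subtopology o_def image_subset_iff)
  have side: "base t \<in> cube_boundary i" if t: "t \<in> bdry lo hi" "t i \<noteq> 0" "t i \<noteq> 1" for t
  proof -
    have tc: "t \<in> cell lo hi" using t bdry_subset_cell by blast
    obtain j where j: "j \<le> i" "t j = 0 \<or> t j = 1"
      using t unfolding bdry_def d by (auto simp: lo_def hi_def)
    with t have "j < i" by (cases "j = i") auto
    moreover have "base t \<in> topspace (unit_cube i)"
      using base_cont tc by (auto simp: continuous_map_def)
    ultimately show ?thesis using j unfolding cube_boundary_def by (auto simp: base_def)
  qed
  have "continuous_on (bdry lo hi) \<Phi>"
    unfolding \<Phi>_def
  proof (rule continuous_on_cases_le)
    show "continuous_on {t \<in> bdry lo hi. t i \<le> 1/2} (\<lambda>t. f (base t))"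
      using bdry_subset_cell by (intro continuous_on_subset[OF lift_cont[OF f(1)]]) auto
    show "continuous_on {t \<in> bdry lo hi. 1/2 \<le> t i} (\<lambda>t. g (base t))"
      using bdry_subset_cell by (intro continuous_on_subset[OF lift_cont[OF g(1)]]) auto
    show "f (base t) = g (base t)" if "t \<in> bdry lo hi" "t i = 1/2" for t
      using side[of t] that f(2) g(2) by simp
  qed (rule continuous_on_coord)
  moreover have "\<Phi> ` bdry lo hi \<subseteq> S"
    using lift_S[OF f(1)] lift_S[OF g(1)] subsetD[OF bdry_subset_cell[of lo hi]] by (auto simp: \<Phi>_def)
  ultimately obtain F where F: "continuous_on (cell lo hi) F" "F ` cell lo hi \<subseteq> S"
    "\<And>t. t \<in> bdry lo hi \<Longrightarrow> F t = \<Phi> t"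
    using S[unfolded fillable_def, rule_format, of lo hi \<Phi>] c by auto
  \<comment> \<open>\<open>E\<close> identifies time and cube with the box, putting time in
    coordinate i; \<open>base\<close> recovers the cube point.\<close>
  define E :: "real \<times> (nat \<Rightarrow> real) \<Rightarrow> nat \<Rightarrow> real"
    where "E = (\<lambda>(u, t) j. if j < i then t j else if j = i then u else 0)"
  have E_cell: "E (u, t) \<in> cell lo hi" if "u \<in> {0..1}" "t \<in> topspace (unit_cube i)" for u t
    using that unfolding topspace_unit_cube cell_def by (auto simp: E_def lo_def hi_def PiE_iff)
  have E_i: "E (u, t) i = u" for u t by (simp add: E_def)
  have E_base: "base (E (u, t)) = t" if "t \<in> topspace (unit_cube i)" for u t
    using that unfolding topspace_unit_cube by (auto simp: E_def base_def PiE_iff extensional_def fun_eq_iff)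
  have "continuous_map (prod_topology (top_of_set {0..1}) (unit_cube i)) euclidean E"
    unfolding euclidean_product_topology[symmetric] continuous_map_componentwise_UNIV
  proof
    fix j
    consider "j < i" | "j = i" | "j > i" by linarith
    then show "continuous_map (prod_topology (top_of_set {0..1}) (unit_cube i)) euclidean (\<lambda>x. E x j)"
    proof cases
      case 1
      have "continuous_map (unit_cube i) (top_of_set {0..1}) (\<lambda>t. t j)"
        unfolding unit_cube_def using 1 by (intro continuous_map_product_projection) simp
      then have "continuous_map (unit_cube i) euclidean (\<lambda>t. t j)"
        by (simp add: continuous_map_in_subtopology)
      from continuous_map_compose[OF continuous_map_snd this] show ?thesis
        using 1 by (simp add: E_def o_def case_prod_unfold)
    next
      case 2
      have "continuous_map (top_of_set {0..1::real}) euclidean (\<lambda>u. u)" by simp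
      from continuous_map_compose[OF continuous_map_fst this] show ?thesis
        using 2 by (simp add: E_def o_def case_prod_unfold)
    next
      case 3 then show ?thesis by (simp add: E_def case_prod_unfold)
    qed
  qed
  then have E_cont: "continuous_map (prod_topology (top_of_set {0..1}) (unit_cube i)) (top_of_set (cell lo hi)) E"
    using E_cell by (auto simp: continuous_map_in_subtopology)
  have F_cont: "continuous_map (top_of_set (cell lo hi)) (top_of_set S) F"
    using F by (simp add: continuous_map_in_subtopology image_subset_iff_funcset)
  have "homotopic_with (\<lambda>h. \<forall>t\<in>cube_boundary i. h t = x0) (unit_cube i) (top_of_set S) f g"
  proof (subst homotopic_with)
    show "(\<forall>t\<in>cube_boundary i. h t = x0) = (\<forall>t\<in>cube_boundary i. k t = x0)"
      if "\<And>x. x \<in> topspace (unit_cube i) \<Longrightarrow> h x = k x" for h k :: "(nat \<Rightarrow> real) \<Rightarrow> 'a"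
      using that by (auto simp: cube_boundary_def)
    have ends: "E (u, t) \<in> bdry lo hi" if "u = 0 \<or> u = 1" "t \<in> topspace (unit_cube i)" for u t
    proof -
      have "E (u, t) \<in> cell lo hi" using E_cell that by auto
      then show ?thesis
        using that(1) unfolding bdry_def d by (auto simp: lo_def hi_def E_i intro!: bexI[of _ i])
    qed
    have "F (E (u, t)) = x0" if u: "u \<in> {0..1}" and t: "t \<in> cube_boundary i" for u t
    proof -
      have tt: "t \<in> topspace (unit_cube i)" using t by (simp add: cube_boundary_def)
      obtain j where j: "j < i" "t j = 0 \<or> t j = 1" using t by (auto simp: cube_boundary_def)
      have "E (u, t) j = t j" using j by (simp add: E_def)
      with j have "E (u, t) \<in> bdry lo hi"
        using E_cell[OF u tt] unfolding bdry_def d by (auto simp: lo_def hi_def intro!: bexI[of _ j])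
      then show ?thesis using F(3) E_base[OF tt] f(2) g(2) t by (simp add: \<Phi>_def)
    qed
    moreover have "F (E (0, t)) = f t" "F (E (1, t)) = g t" if "t \<in> topspace (unit_cube i)" for t
      using F(3) ends[OF _ that] E_base[OF that] by (simp_all add: \<Phi>_def E_i)
    ultimately show "\<exists>h. continuous_map (prod_topology (top_of_set {0..1::real}) (unit_cube i)) (top_of_set S) h \<and>
        (\<forall>x\<in>topspace (unit_cube i). h (0, x) = f x) \<and> (\<forall>x\<in>topspace (unit_cube i). h (1, x) = g x) \<and>
        (\<forall>t\<in>{0..1}. \<forall>u\<in>cube_boundary i. h (t, u) = x0)"
      using continuous_map_compose[OF E_cont F_cont] by (intro exI[where x = "F \<circ> E"]) simp
  qed
  then show "(f, g) \<in> based_homotopy_rel i (top_of_set S) x0"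
    by (simp add: based_homotopy_rel_def)
qed

lemma fillable_0_nonempty: "fillable 0 S \<Longrightarrow> S \<noteq> {}"
proof -
  assume S: "fillable 0 S"
  have "is_cell 0 (\<lambda>_. 0) (\<lambda>_. 0)" "bdry (\<lambda>_. 0) (\<lambda>_. 0) = {}"
    by (auto simp: is_cell_def bdry_def dirs_def)
  then obtain F where "F ` cell (\<lambda>_. 0) (\<lambda>_. 0) \<subseteq> S"
    using S unfolding fillable_def by (metis continuous_on_empty empty_subsetI image_empty)
  moreover have "(\<lambda>_. 0) \<in> cell (\<lambda>_. 0) (\<lambda>_. 0)" by (simp add: cell_def)
  ultimately show ?thesis by blast
qed

section \<open>From fillings to the symmetric chessboard complex\<close>

lemma geometric_realization_eq: "geometric_realization K = top_of_set (realization K)"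
  by (simp add: geometric_realization_def realization_def euclidean_product_topology)

text \<open>The i-th group needs cubes of dimension i + 1, and \<open>i \<le> D - 2\<close> puts
  these below \<open>D\<close>; nonemptiness, needed from \<open>\<mu> = -1\<close> on, is the
  filling of the 0-cube.\<close>

lemma fills_below_imp_mu_connected:
  assumes "fills_below D K" and \<mu>: "\<mu> = int D - 2"
  shows "mu_connected \<mu> (geometric_realization K)"
  unfolding mu_connected_def geometric_realization_eq
proof (intro conjI impI allI ballI)
  assume "- 1 \<le> \<mu>"
  then have "0 < D" using \<mu> by simp
  then show "topspace (top_of_set (realization K)) \<noteq> {}"
    using assms(1) fillable_0_nonempty by (auto simp: fills_below_def)
next
  fix i x0 assume "int i \<le> \<mu>" and x0: "x0 \<in> topspace (top_of_set (realization K))"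
  then have "Suc i < D" using \<mu> by simp
  then show "is_singleton (homotopy_group i (top_of_set (realization K)) x0)"
    using assms(1) x0 by (intro fillable_imp_homotopy_group_trivial) (auto simp: fills_below_def)
qed

text \<open>Moves the rows that exceed their capacity onto the first indices, where the larger
  values of \<open>k\<close> sit.\<close>

lemma permutes_into_initial_segment:
  assumes "T \<subseteq> {1..n}"
  shows "\<exists>\<pi>. \<pi> permutes {1..n} \<and> \<pi> ` T = {1..card T}"
proof -
  have fin: "finite T" using assms finite_subset by blast
  have le: "card T \<le> n" using card_mono[OF _ assms] by simp
  obtain f where f: "bij_betw f T {1..card T}"
    using finite_same_card_bij[OF fin, of "{1..card T}"] by auto
  have "card ({1..n} - T) = card ({1..n} - {1..card T})"
    using assms le fin by (simp add: card_Diff_subset)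
  then obtain g where g: "bij_betw g ({1..n} - T) ({1..n} - {1..card T})"
    using finite_same_card_bij[of "{1..n} - T" "{1..n} - {1..card T}"] by blast
  define \<pi> where "\<pi> x = (if x \<in> T then f x else if x \<in> {1..n} then g x else x)" for x
  have "bij_betw \<pi> T {1..card T}" using f by (rule bij_betw_cong[THEN iffD1, rotated]) (simp add: \<pi>_def)
  moreover have "bij_betw \<pi> ({1..n} - T) ({1..n} - {1..card T})"
    using g by (rule bij_betw_cong[THEN iffD1, rotated]) (simp add: \<pi>_def)
  ultimately have "bij_betw \<pi> (T \<union> ({1..n} - T)) ({1..card T} \<union> ({1..n} - {1..card T}))"
    by (rule bij_betw_combine) auto
  moreover have "T \<union> ({1..n} - T) = {1..n}" "{1..card T} \<union> ({1..n} - {1..card T}) = {1..n}"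
    using assms le by auto
  ultimately have "\<pi> permutes {1..n}"
    using assms by (intro bij_imp_permutes) (auto simp: \<pi>_def)
  moreover have "\<pi> ` T = {1..card T}" using \<open>bij_betw \<pi> T _\<close> by (simp add: bij_betw_def)
  ultimately show ?thesis by blast
qed

lemma inj_on_fst_iff:
  fixes m n :: nat
  assumes "A \<subseteq> {1..m} \<times> {1..n}"
  shows "inj_on fst A \<longleftrightarrow> (\<forall>c\<in>{1..m}. card {p\<in>A. fst p = c} \<le> 1)"
proof -
  have "finite A" using assms by (rule finite_subset) simp
  then have fin: "finite {p\<in>A. fst p = c}" for c by simp
  show ?thesis
  proof
    assume inj: "inj_on fst A"
    show "\<forall>c\<in>{1..m}. card {p\<in>A. fst p = c} \<le> 1"
      using inj fin unfolding One_nat_def by (subst card_le_Suc0_iff_eq) (auto simp: inj_on_def)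
  next
    assume *: "\<forall>c\<in>{1..m}. card {p\<in>A. fst p = c} \<le> 1"
    show "inj_on fst A"
    proof (rule inj_onI)
      fix x y assume xy: "x \<in> A" "y \<in> A" "fst x = fst y"
      then have "fst x \<in> {1..m}" using assms by auto
      then have "card {p\<in>A. fst p = fst x} \<le> Suc 0" using * by simp
      then have "\<forall>p\<in>{p\<in>A. fst p = fst x}. \<forall>q\<in>{p\<in>A. fst p = fst x}. p = q"
        using card_le_Suc0_iff_eq[OF fin] by blast
      moreover have "x \<in> {p\<in>A. fst p = fst x}" "y \<in> {p\<in>A. fst p = fst x}" using xy by simp_all
      ultimately show "x = y" by (meson bspec)
    qed
  qed
qed

text \<open>A permutation suits \<open>A\<close> exactly when it sends every row with
  \<open>\<nu> + 1\<close> rooks into \<open>{1..s}\<close> and no row holds more. Such a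
  permutation exists precisely if there are at most \<open>s\<close> of these rows.\<close>

lemma symmetric_multiple_chessboard_complex_eq:
  assumes s: "s \<le> n" and k1: "\<forall>i\<in>{1..s}. k i = \<nu> + 1" and k2: "\<forall>i\<in>{s+1..n}. k i = \<nu>"
  shows "symmetric_multiple_chessboard_complex m n k =
         rook_complex (chessboard m n) {1..n} (\<lambda>_. \<nu>) s"
proof (intro set_eqI iffI)
  have k: "k i = (if i \<le> s then Suc \<nu> else \<nu>)" if "i \<in> {1..n}" for i
    using that k1 k2 by (cases "i \<le> s") auto
  fix A
  {
    assume "A \<in> symmetric_multiple_chessboard_complex m n k"
    then obtain \<pi> where \<pi>: "\<pi> permutes {1..n}" and A: "A \<subseteq> chessboard m n"
      "\<forall>c\<in>{1..m}. card {p\<in>A. fst p = c} \<le> 1" "\<And>r. r \<in> {1..n} \<Longrightarrow> row_card A r \<le> k (\<pi> r)"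
      unfolding symmetric_multiple_chessboard_complex_def multiple_chessboard_complex_def row_card_def
      by auto
    have \<pi>n: "\<pi> r \<in> {1..n}" if "r \<in> {1..n}" for r using permutes_in_image[OF \<pi>] that by blast
    have "\<pi> ` {r\<in>{1..n}. \<nu> < row_card A r} \<subseteq> {1..s}"
    proof clarify
      fix r assume r: "r \<in> {1..n}" "\<nu> < row_card A r"
      then show "\<pi> r \<in> {1..s}" using A(3)[OF r(1)] k[OF \<pi>n[OF r(1)]] \<pi>n[OF r(1)] by (auto split: if_splits)
    qed
    then have "card {r\<in>{1..n}. \<nu> < row_card A r} \<le> card {1..s}"
      by (intro card_inj_on_le[OF permutes_inj_on[OF \<pi>]]) auto
    moreover have "row_card A r \<le> Suc \<nu>" if "r \<in> {1..n}" for r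
      using A(3)[OF that] k[OF \<pi>n[OF that]] by (auto split: if_splits)
    moreover have "inj_on fst A" using A(1,2) inj_on_fst_iff unfolding chessboard_def by blast
    ultimately show "A \<in> rook_complex (chessboard m n) {1..n} (\<lambda>_. \<nu>) s"
      using A(1) by (simp add: rook_complex_def)
  next
    assume "A \<in> rook_complex (chessboard m n) {1..n} (\<lambda>_. \<nu>) s"
    then have A: "A \<subseteq> chessboard m n" "inj_on fst A" "\<And>r. r \<in> {1..n} \<Longrightarrow> row_card A r \<le> Suc \<nu>"
      and T: "card {r\<in>{1..n}. \<nu> < row_card A r} \<le> s"
      by (auto simp: rook_complex_def)
    let ?T = "{r\<in>{1..n}. \<nu> < row_card A r}"
    obtain \<pi> where \<pi>: "\<pi> permutes {1..n}" "\<pi> ` ?T = {1..card ?T}"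
      using permutes_into_initial_segment[of ?T n] by blast
    have "row_card A r \<le> k (\<pi> r)" if r: "r \<in> {1..n}" for r
    proof -
      have kr: "k (\<pi> r) = (if \<pi> r \<le> s then Suc \<nu> else \<nu>)"
        using k permutes_in_image[OF \<pi>(1)] r by blast
      show ?thesis
      proof (cases "\<nu> < row_card A r")
        case True
        then have "\<pi> r \<in> {1..card ?T}" using r \<pi>(2) by blast
        then have "\<pi> r \<le> s" using T by simp
        then show ?thesis using kr A(3)[OF r] by simp
      next
        case False
        then show ?thesis using kr by simp
      qed
    qed
    moreover have "\<forall>c\<in>{1..m}. card {p\<in>A. fst p = c} \<le> 1"
      using A(1,2) inj_on_fst_iff unfolding chessboard_def by blast
    ultimately show "A \<in> symmetric_multiple_chessboard_complex m n k"
      using \<pi>(1) A(1)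
      unfolding symmetric_multiple_chessboard_complex_def multiple_chessboard_complex_def row_card_def
      by blast
  }
qed

lemma row_card_chessboard: "r \<in> {1..n} \<Longrightarrow> row_card (chessboard m n) r = m"
proof -
  assume "r \<in> {1..n}"
  then have "{x \<in> chessboard m n. snd x = r} = {1..m} \<times> {r}" by (auto simp: chessboard_def)
  then show ?thesis by (simp add: row_card_def card_cartesian_product)
qed

theorem theorem3p3:
  fixes m n \<nu> s :: nat and k :: "nat \<Rightarrow> nat" and \<mu> :: int
  assumes "m \<ge> 1" and "n \<ge> 1" and "s \<le> n"
    and "\<forall>i\<in>{1..s}. k i = \<nu> + 1"
    and "\<forall>i\<in>{s+1..n}. k i = \<nu>"
    and "int m \<ge> int n * (int \<nu> + 1) + int s - 1"
    and "\<mu> = (\<Sum>i=1..n. int (k i)) - 2"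
  shows "\<mu> = int \<nu> * int n + int s - 2 \<and>
         mu_connected \<mu> (geometric_realization (symmetric_multiple_chessboard_complex m n k))"
proof
  have "(\<Sum>i=1..n. int (k i)) = (\<Sum>i\<in>{1..s}. int (k i)) + (\<Sum>i\<in>{s+1..n}. int (k i))"
    using assms(3) by (subst sum.union_disjoint[symmetric]) (auto intro: sum.cong)
  also have "\<dots> = (\<Sum>i\<in>{1..s}. int \<nu> + 1) + (\<Sum>i\<in>{s+1..n}. int \<nu>)"
    using assms(4,5) by (intro arg_cong2[where f = "(+)"] sum.cong) auto
  also have "\<dots> = int \<nu> * int n + int s"
    using assms(3) by (simp add: of_nat_diff algebra_simps)
  finally show \<mu>: "\<mu> = int \<nu> * int n + int s - 2" using assms(7) by simp
  \<comment> \<open>The 1 is moved to the other side so that no truncated subtraction arises over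
    the naturals.\<close>
  have "int (n * \<nu> + n + s) \<le> int (m + 1)" using assms(6) by (simp add: algebra_simps)
  then have "n * \<nu> + n + s \<le> m + 1" by (simp only: of_nat_le_iff)
  then have "rich (chessboard m n) {1..n} (\<lambda>_. \<nu>) s"
    unfolding rich_def using assms(3) by (auto simp: row_card_chessboard) (auto simp: chessboard_def)
  then have "fills_below (sum (\<lambda>_. \<nu>) {1..n} + s) (rook_complex (chessboard m n) {1..n} (\<lambda>_. \<nu>) s)"
    using rich_fills by blast
  then show "mu_connected \<mu> (geometric_realization (symmetric_multiple_chessboard_complex m n k))"
    unfolding symmetric_multiple_chessboard_complex_eq[OF assms(3-5)]
    by (rule fills_below_imp_mu_connected) (simp add: \<mu>)
qed

end
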